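(* Let $r_c>0$. For every $\mu>0$, $\beta>0$ and $\tau_{\mathrm{max}}>0$, the system $\Sigma_{\mathrm{sat}}$ is controllable for the orbital transfer problem with thrust bound $\tau_{\mathrm{max}}$. That is, for every initial mass $m_i>0$ and all points $\boldsymbol{x}_i,\boldsymbol{x}_f\in\mathcal{P}^+$, there exist a finite time $t_f\ge 0$, a constant $M_0>0$, and a measurable control $\boldsymbol{\tau}:[0,t_f]\to\mathcal{T}(\tau_{\mathrm{max}})$ such that the trajectory $(\boldsymbol{x}(\cdot),m(\cdot))$ of $\Sigma_{\mathrm{sat}}$ starting from $(\boldsymbol{x}_i,m_i)$ and associated with $\boldsymbol{\tau}(\cdot)$ is defined on $[0,t_f]$, satisfies $\boldsymbol{x}(t)\in\mathcal{A}$ and $m(t)\ge M_0$ for all $t\in[0,t_f]$, and satisfies $\boldsymbol{x}(t_f)=\boldsymbol{x}_f$.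
   Context: Let $\mu,\beta,r_c>0$ be constants and let $\|\cdot\|$ be the Euclidean norm. The system $\Sigma_{\mathrm{sat}}$ with state $(\boldsymbol{r},\boldsymbol{v},m)\in(\mathbb{R}^3\setminus\{0\})\times\mathbb{R}^3\times(0,\infty)$ is $$\dot{\boldsymbol{r}}=\boldsymbol{v},\qquad \dot{\boldsymbol{v}}=-\frac{\mu}{\|\boldsymbol{r}\|^3}\boldsymbol{r}+\frac{\boldsymbol{\tau}}{m},\qquad \dot m=-\beta\|\boldsymbol{\tau}\|,$$ where the control $\boldsymbol{\tau}(\cdot)$ is measurable with values in $\mathcal{T}(\tau_{\mathrm{max}})=\{\boldsymbol{\tau}\in\mathbb{R}^3:\|\boldsymbol{\tau}\|\le\tau_{\mathrm{max}}\}$. Write $\boldsymbol{x}=(\boldsymbol{r},\boldsymbol{v})$. For $\boldsymbol{x}=(\boldsymbol{r},\boldsymbol{v})$ with $\boldsymbol{r}\ne0$ put $\boldsymbol{h}=\boldsymbol{r}\times\boldsymbol{v}$, $\boldsymbol{L}=\boldsymbol{v}\times\boldsymbol{h}-\mu\,\boldsymbol{r}/\|\boldsymbol{r}\|$, $E=\|\boldsymbol{v}\|^2/2-\mu/\|\boldsymbol{r}\|$, $e(\boldsymbol{x})=\|\boldsymbol{L}\|/\mu$. The periodic region is $\mathcal{P}=\{\boldsymbol{x}:\boldsymbol{h}\ne0,\ E<0\}$ (on which $e<1$). On $\mathcal{P}$ the perigee distance is $r_p(\boldsymbol{x})=\|\boldsymbol{h}\|^2/(\mu(1+e(\boldsymbol{x})))$.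 The admissible region is $\mathcal{A}=\{\boldsymbol{x}=(\boldsymbol{r},\boldsymbol{v})\in\mathcal{P}:\|\boldsymbol{r}\|>r_c\}$, and the stable periodic region is $\mathcal{P}^+=\{\boldsymbol{x}\in\mathcal{P}:r_p(\boldsymbol{x})>r_c\}$. *)

theory Defs
  imports "HOL-Analysis.Analysis"
begin

section \<open>Keplerian orbits\<close>

type_synonym orbit_state = "(real ^ 3) \<times> (real ^ 3)"

definition ang_mom :: "orbit_state \<Rightarrow> real ^ 3" where
  "ang_mom = (\<lambda>(r, v). cross3 r v)"

definition laplace_vec :: "real \<Rightarrow> orbit_state \<Rightarrow> real ^ 3" where
  "laplace_vec \<mu> = (\<lambda>(r, v). cross3 v (ang_mom (r, v)) - (\<mu> / norm r) *\<^sub>R r)"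

definition energy :: "real \<Rightarrow> orbit_state \<Rightarrow> real" where
  "energy \<mu> = (\<lambda>(r, v). (norm v)\<^sup>2 / 2 - \<mu> / norm r)"

definition eccentricity :: "real \<Rightarrow> orbit_state \<Rightarrow> real" where
  "eccentricity \<mu> x = norm (laplace_vec \<mu> x) / \<mu>"

definition perigee :: "real \<Rightarrow> orbit_state \<Rightarrow> real" where
  "perigee \<mu> x = (norm (ang_mom x))\<^sup>2 / (\<mu> * (1 + eccentricity \<mu> x))"

definition periodic_region :: "real \<Rightarrow> orbit_state set" where
  "periodic_region \<mu> = {x. fst x \<noteq> 0 \<and> ang_mom x \<noteq> 0 \<and> energy \<mu> x < 0}"

definition admissible_region :: "real \<Rightarrow> real \<Rightarrow> orbit_state set" where
  "admissible_region \<mu> r\<^sub>c = {x \<in> periodic_region \<mu>. norm (fst x) > r\<^sub>c}"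

definition stable_periodic_region :: "real \<Rightarrow> real \<Rightarrow> orbit_state set" where
  "stable_periodic_region \<mu> r\<^sub>c = {x \<in> periodic_region \<mu>. perigee \<mu> x > r\<^sub>c}"

section \<open>The controlled system\<close>

definition state_space :: "(orbit_state \<times> real) set" where
  "state_space = {((r, v), m). r \<noteq> 0 \<and> m > 0}"

definition sat_field ::
    "real \<Rightarrow> real \<Rightarrow> real ^ 3 \<Rightarrow> orbit_state \<times> real \<Rightarrow> orbit_state \<times> real" where
  "sat_field \<mu> \<beta> \<tau> = (\<lambda>((r, v), m).
     ((v, - (\<mu> / norm r ^ 3) *\<^sub>R r + (1 / m) *\<^sub>R \<tau>), - \<beta> * norm \<tau>))"

definition thrust_set :: "real \<Rightarrow> (real ^ 3) set" where
  "thrust_set \<tau>max = {\<tau>. norm \<tau> \<le> \<tau>max}"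

definition admissible_control :: "real \<Rightarrow> real \<Rightarrow> (real \<Rightarrow> real ^ 3) \<Rightarrow> bool" where
  "admissible_control \<tau>max T \<tau> \<longleftrightarrow>
     \<tau> \<in> borel_measurable (lebesgue_on {0..T}) \<and> (\<forall>t\<in>{0..T}. \<tau> t \<in> thrust_set \<tau>max)"

text \<open>Absolute continuity of a function on a compact interval. (The constant
  \<open>absolutely_continuous\<close> of the library is the corresponding notion for measures.)
  A pair \<open>(s, t)\<close> in \<open>D\<close> stands for the interval from \<open>s\<close> to \<open>t\<close>.\<close>

definition abs_continuous_on :: "real \<Rightarrow> real \<Rightarrow> (real \<Rightarrow> 'a::metric_space) \<Rightarrow> bool" where
  "abs_continuous_on a b f \<longleftrightarrow>
     (\<forall>\<epsilon>>0. \<exists>\<delta>>0. \<forall>D.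
        finite D \<and> (\<forall>(s, t)\<in>D. a \<le> s \<and> s < t \<and> t \<le> b) \<and>
        disjoint_family_on (\<lambda>(s, t). {s<..<t}) D \<and> (\<Sum>(s, t)\<in>D. t - s) < \<delta> \<longrightarrow>
        (\<Sum>(s, t)\<in>D. dist (f s) (f t)) < \<epsilon>)"

text \<open>As the control is only measurable, trajectories are Caratheodory solutions: absolutely
  continuous curves in the state space that satisfy the equation at almost every time.\<close>

definition trajectory_on ::
    "real \<Rightarrow> real \<Rightarrow> (real \<Rightarrow> real ^ 3) \<Rightarrow> orbit_state \<times> real \<Rightarrow> real \<Rightarrow>
     (real \<Rightarrow> orbit_state) \<Rightarrow> (real \<Rightarrow> real) \<Rightarrow> bool" where
  "trajectory_on \<mu> \<beta> \<tau> z\<^sub>0 T x m \<longleftrightarrow>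
     (x 0, m 0) = z\<^sub>0 \<and>
     (\<forall>t\<in>{0..T}. (x t, m t) \<in> state_space) \<and>
     abs_continuous_on 0 T (\<lambda>t. (x t, m t)) \<and>
     (AE t in lebesgue_on {0..T}.
        ((\<lambda>s. (x s, m s)) has_vector_derivative sat_field \<mu> \<beta> (\<tau> t) (x t, m t))
          (at t within {0..T}))"

definition controllable_orbital_transfer :: "real \<Rightarrow> real \<Rightarrow> real \<Rightarrow> real \<Rightarrow> bool" where
  "controllable_orbital_transfer \<mu> \<beta> r\<^sub>c \<tau>max \<longleftrightarrow>
     (\<forall>m\<^sub>i>0. \<forall>x\<^sub>i\<in>stable_periodic_region \<mu> r\<^sub>c. \<forall>x\<^sub>f\<in>stable_periodic_region \<mu> r\<^sub>c.
        \<exists>t\<^sub>f\<ge>0. \<exists>M\<^sub>0>0. \<exists>\<tau>. admissible_control \<tau>max t\<^sub>f \<tau> \<and>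
          (\<exists>x m. trajectory_on \<mu> \<beta> \<tau> (x\<^sub>i, m\<^sub>i) t\<^sub>f x m \<and>
             (\<forall>t\<in>{0..t\<^sub>f}. x t \<in> admissible_region \<mu> r\<^sub>c \<and> m t \<ge> M\<^sub>0) \<and>
             x t\<^sub>f = x\<^sub>f))"

end

theory Submission
  imports Defs
begin

text \<open>
  Why arbitrarily small thrust suffices: a free orbit is periodic, so the satellite can wait on it
  for as long as it likes, and a transfer may be cut into many tiny changes of orbit.

  The mass drops out first. Prescribing the acceleration \<open>u = \<tau> / m\<close> instead of the thrust turns
  \<open>m' = - \<beta> norm \<tau>\<close> into \<open>m' = - \<beta> m norm u\<close>, whose solution is an exponential and stays positive.
  Since the mass only decreases, the bound \<open>norm u \<le> \<tau>max / m\<^sub>i\<close> at the initial mass \<open>m\<^sub>i\<close> keeps the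
  thrust admissible for ever. Hence it is enough to move between orbits with accelerations below a
  fixed but arbitrary bound.

  Free motion is explicit in the fictitious time \<open>s\<close> with \<open>dt = norm r ds\<close>: there the Kepler equation is
  linear, its solutions are trigonometric polynomials in \<open>s\<close>, and they depend continuously
  on the initial state. Energy, Laplace vector and length of the angular momentum are conserved,
  so the free orbit of a point of the stable region stays there, and it is closed.

  For two states \<open>y\<close> and \<open>z\<close> close to \<open>x\<close>, the free motions from \<open>y\<close> and from \<open>z\<close> remain close during one
  unit of fictitious time, together with two derivatives. Blending the first smoothly into the second
  therefore needs only a small acceleration and ends on the orbit of \<open>z\<close>; coasting along
  that closed orbit reaches \<open>z\<close> itself (\<open>reach_locally\<close>). Mutual reachability is thus an equivalence
  relation that holds locally, and it holds globally on every connected set of stable states. Every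
  stable orbit passes through its perigee (\<open>coast_meets_apses\<close>), and the perigee states form a
  connected set (\<open>connected_apses\<close>) because the pairs of orthonormal vectors in space do.
\<close>

section \<open>Conserved quantities and the perigee\<close>

lemma laplace_vec_eq:
  "laplace_vec \<mu> (r, v) = ((norm v)\<^sup>2 - \<mu> / norm r) *\<^sub>R r - (r \<bullet> v) *\<^sub>R v"
proof -
  have "cross3 v (cross3 r v) = (v \<bullet> v) *\<^sub>R r - (v \<bullet> r) *\<^sub>R v"
    by (rule Lagrange)
  then show ?thesis
    by (simp add: laplace_vec_def ang_mom_def power2_norm_eq_inner inner_commute algebra_simps)
qed

lemma norm_ang_mom: "(norm (ang_mom (r, v)))\<^sup>2 = (norm r)\<^sup>2 * (norm v)\<^sup>2 - (r \<bullet> v)\<^sup>2"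
  using norm_cross_dot[of r v] by (simp add: ang_mom_def power_mult_distrib)

text \<open>This relation determines the length of the angular momentum from
  the energy and the Laplace vector, so conservation of the latter two will be enough.\<close>

lemma norm_laplace_vec:
  assumes "r \<noteq> 0"
  shows "(norm (laplace_vec \<mu> (r, v)))\<^sup>2 = \<mu>\<^sup>2 + 2 * energy \<mu> (r, v) * (norm (ang_mom (r, v)))\<^sup>2"
proof -
  define d k q w where dkq: "d = norm r" "k = \<mu> / norm r" "q = r \<bullet> v" "w = norm v"
  have "d \<noteq> 0" using assms by (simp add: dkq)
  then have mu: "\<mu> = k * d" by (simp add: dkq)
  have inn: "r \<bullet> r = d\<^sup>2" "v \<bullet> v = w\<^sup>2" "v \<bullet> r = q" "r \<bullet> v = q"
    by (simp_all add: dkq power2_norm_eq_inner inner_commute)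
  have L: "laplace_vec \<mu> (r, v) = (w\<^sup>2 - k) *\<^sub>R r - q *\<^sub>R v"
    by (simp add: laplace_vec_eq dkq)
  have E: "energy \<mu> (r, v) = w\<^sup>2 / 2 - k" by (simp add: energy_def dkq)
  have H: "(norm (ang_mom (r, v)))\<^sup>2 = d\<^sup>2 * w\<^sup>2 - q\<^sup>2"
    by (simp add: norm_ang_mom dkq)
  show ?thesis
    unfolding L E H power2_norm_eq_inner[of "_ - _"] unfolding mu
    by (simp add: inner_diff_left inner_diff_right inn)
       (simp add: algebra_simps power2_eq_square)
qed

lemma inner_laplace_vec:
  assumes "r \<noteq> 0"
  shows "laplace_vec \<mu> (r, v) \<bullet> r = (norm (ang_mom (r, v)))\<^sup>2 - \<mu> * norm r"
  using assms
  by (simp add: laplace_vec_eq norm_ang_mom inner_diff_left inner_commute[of v r]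
      power2_norm_eq_inner[symmetric] field_simps)
     (simp add: power2_eq_square algebra_simps)

text \<open>The polar equation of the conic: \<open>(norm h)\<^sup>2 = L \<bullet> r + \<mu> norm r\<close>, where \<open>L \<bullet> r\<close> is at most
  \<open>norm L * norm r\<close>, with equality at the perigee.\<close>

lemma perigee_le_norm:
  assumes "\<mu> > 0" "fst x \<noteq> 0"
  shows "perigee \<mu> x \<le> norm (fst x)"
proof -
  obtain r v where x: "x = (r, v)" by (cases x)
  have r: "r \<noteq> 0" using assms x by simp
  have "(norm (ang_mom x))\<^sup>2 = laplace_vec \<mu> x \<bullet> r + \<mu> * norm r"
    using inner_laplace_vec[OF r] x by simp
  also have "\<dots> \<le> norm (laplace_vec \<mu> x) * norm r + \<mu> * norm r"
    using Cauchy_Schwarz_ineq2[of "laplace_vec \<mu> x" r] by simp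
  also have "\<dots> = norm r * (\<mu> * (1 + eccentricity \<mu> x))"
    using assms by (simp add: eccentricity_def field_simps)
  finally have *: "(norm (ang_mom x))\<^sup>2 \<le> norm r * (\<mu> * (1 + eccentricity \<mu> x))" .
  have "eccentricity \<mu> x \<ge> 0" using assms by (simp add: eccentricity_def)
  then have "\<mu> * (1 + eccentricity \<mu> x) > 0" using assms by simp
  with * show ?thesis unfolding perigee_def x
    by (simp add: divide_le_eq x)
qed

lemma stable_subset_admissible:
  assumes "\<mu> > 0"
  shows "stable_periodic_region \<mu> r\<^sub>c \<subseteq> admissible_region \<mu> r\<^sub>c"
  using order_less_le_trans[OF _ perigee_le_norm[OF assms]]
  by (auto simp: stable_periodic_region_def admissible_region_def periodic_region_def)

section \<open>Free motion in fictitious time\<close>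

text \<open>With a prime for the derivative in the fictitious time \<open>s\<close>, where \<open>dt = norm R ds\<close>, the Kepler
  equation becomes the linear equation \<open>R'' = 2 E R - L\<close>, with the constants energy \<open>E\<close> and Laplace
  vector \<open>L\<close>. For \<open>E < 0\<close> it describes a shifted harmonic oscillator of the following frequency.\<close>

definition freq :: "real \<Rightarrow> orbit_state \<Rightarrow> real" where
  "freq \<mu> x = sqrt (- 2 * energy \<mu> x)"

text \<open>The solution with \<open>R 0 = r\<close> and \<open>R' 0 = norm r *\<^sub>R v\<close>, expanded in \<open>r\<close> and \<open>v\<close>; it is followed by its
  first two derivatives in \<open>s\<close>.\<close>

definition coast_pos :: "real \<Rightarrow> orbit_state \<Rightarrow> real \<Rightarrow> real ^ 3" where
  "coast_pos \<mu> x s = (let r = fst x; v = snd x; w = freq \<mu> x in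
     (1 - \<mu> / norm r / w\<^sup>2 * (1 - cos (w * s))) *\<^sub>R r
     + (norm r / w * sin (w * s) + (r \<bullet> v) / w\<^sup>2 * (1 - cos (w * s))) *\<^sub>R v)"

definition coast_pos' :: "real \<Rightarrow> orbit_state \<Rightarrow> real \<Rightarrow> real ^ 3" where
  "coast_pos' \<mu> x s = (let r = fst x; v = snd x; w = freq \<mu> x in
     (- \<mu> / norm r / w * sin (w * s)) *\<^sub>R r
     + (norm r * cos (w * s) + (r \<bullet> v) / w * sin (w * s)) *\<^sub>R v)"

definition coast_pos'' :: "real \<Rightarrow> orbit_state \<Rightarrow> real \<Rightarrow> real ^ 3" where
  "coast_pos'' \<mu> x s = (let r = fst x; v = snd x; w = freq \<mu> x in
     (- \<mu> / norm r * cos (w * s)) *\<^sub>R r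
     + ((r \<bullet> v) * cos (w * s) - w * norm r * sin (w * s)) *\<^sub>R v)"

text \<open>The distance from the attracting centre solves the scalar analogue \<open>d'' = 2 E d + \<mu>\<close>. It is defined
  by the solution of this equation and shown below to be the norm of the position.\<close>

definition coast_dist :: "real \<Rightarrow> orbit_state \<Rightarrow> real \<Rightarrow> real" where
  "coast_dist \<mu> x s = (let r = fst x; v = snd x; w = freq \<mu> x in
     \<mu> / w\<^sup>2 + (norm r - \<mu> / w\<^sup>2) * cos (w * s) + (r \<bullet> v) / w * sin (w * s))"

definition coast_dist' :: "real \<Rightarrow> orbit_state \<Rightarrow> real \<Rightarrow> real" where
  "coast_dist' \<mu> x s = (let r = fst x; v = snd x; w = freq \<mu> x in
     - w * (norm r - \<mu> / w\<^sup>2) * sin (w * s) + (r \<bullet> v) * cos (w * s))"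

text \<open>Dividing by \<open>norm R\<close> converts the derivative in \<open>s\<close> into the velocity in physical time.\<close>

definition coast :: "real \<Rightarrow> orbit_state \<Rightarrow> real \<Rightarrow> orbit_state" where
  "coast \<mu> x s = (coast_pos \<mu> x s, (1 / norm (coast_pos \<mu> x s)) *\<^sub>R coast_pos' \<mu> x s)"

lemma freq_pos: "x \<in> periodic_region \<mu> \<Longrightarrow> freq \<mu> x > 0"
  by (simp add: periodic_region_def freq_def)

lemma coast_0:
  assumes "fst x \<noteq> 0"
  shows "coast \<mu> x 0 = x"
  using assms by (cases x) (simp add: coast_def coast_pos_def coast_pos'_def)

lemma coast_periodic:
  assumes "x \<in> periodic_region \<mu>"
  shows "coast \<mu> x (s + real n * (2 * pi / freq \<mu> x)) = coast \<mu> x s"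
proof -
  define w where "w = freq \<mu> x"
  have "w > 0" using freq_pos[OF assms] by (simp add: w_def)
  then have "w * (s + real n * (2 * pi / w)) = w * s + 2 * pi * real n"
    by (simp add: field_simps)
  moreover have "cos (w * s + 2 * pi * real n) = cos (w * s)"
     "sin (w * s + 2 * pi * real n) = sin (w * s)"
    using cos_int_2pin[of "int n"] sin_int_2pin[of "int n"] by (simp_all add: cos_add sin_add)
  ultimately show ?thesis
    by (simp add: coast_def coast_pos_def coast_pos'_def Let_def flip: w_def)
qed

lemma has_vector_derivative_combination:
  assumes "(f has_real_derivative f') F" "(g has_real_derivative g') F"
  shows "((\<lambda>s. f s *\<^sub>R a + g s *\<^sub>R b) has_vector_derivative f' *\<^sub>R a + g' *\<^sub>R b) F"
  using assms bounded_linear.has_vector_derivative[OF bounded_linear_scaleR_left]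
  by (auto simp: has_real_derivative_iff_has_vector_derivative intro!: has_vector_derivative_add)

lemma has_derivative_coast_pos:
  assumes "x \<in> periodic_region \<mu>"
  shows "(coast_pos \<mu> x has_vector_derivative coast_pos' \<mu> x s) (at s within A)"
  unfolding coast_pos_def coast_pos'_def Let_def
  using freq_pos[OF assms] assms
  by (intro has_vector_derivative_combination)
     (auto intro!: derivative_eq_intros simp: field_simps power2_eq_square periodic_region_def)

lemma has_derivative_coast_pos':
  assumes "x \<in> periodic_region \<mu>"
  shows "(coast_pos' \<mu> x has_vector_derivative coast_pos'' \<mu> x s) (at s within A)"
  unfolding coast_pos'_def coast_pos''_def Let_def
  using freq_pos[OF assms] assms
  by (intro has_vector_derivative_combination)
     (auto intro!: derivative_eq_intros simp: field_simps power2_eq_square periodic_region_def)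

lemma has_derivative_coast_dist:
  assumes "x \<in> periodic_region \<mu>"
  shows "(coast_dist \<mu> x has_real_derivative coast_dist' \<mu> x s) (at s within A)"
  unfolding coast_dist_def coast_dist'_def Let_def
  using freq_pos[OF assms]
  by (auto intro!: derivative_eq_intros simp: field_simps power2_eq_square)

lemma has_derivative_coast_dist':
  assumes "x \<in> periodic_region \<mu>"
  shows "(coast_dist' \<mu> x has_real_derivative \<mu> - (freq \<mu> x)\<^sup>2 * coast_dist \<mu> x s) (at s within A)"
  unfolding coast_dist_def coast_dist'_def Let_def
  using freq_pos[OF assms]
  by (auto intro!: derivative_eq_intros simp: field_simps power2_eq_square)

text \<open>The equations compare coefficients of \<open>r\<close> and \<open>v\<close>, or of their inner products, and follow from
  \<open>cos\<^sup>2 + sin\<^sup>2 = 1\<close> and \<open>w\<^sup>2 = 2 \<mu> / norm r - (norm v)\<^sup>2\<close>. Positivity of the distance is where the angular momentum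
  enters: the oscillation about the mean value \<open>\<mu> / w\<^sup>2\<close> has squared amplitude
  \<open>(\<mu> / w\<^sup>2)\<^sup>2 - (norm h)\<^sup>2 / w\<^sup>2\<close>, so a non-zero \<open>h\<close> excludes a collision. The identity \<open>coast_pos_ode\<close>
  is Newton's equation for \<open>R\<close>, multiplied by a power of the distance.\<close>

lemma
  assumes mu: "\<mu> > 0" and x: "x \<in> periodic_region \<mu>"
  shows coast_dist_pos: "coast_dist \<mu> x s > 0"
    and norm_coast_pos: "norm (coast_pos \<mu> x s) = coast_dist \<mu> x s"
    and coast_pos_ode: "\<mu> *\<^sub>R coast_pos \<mu> x s + coast_dist \<mu> x s *\<^sub>R coast_pos'' \<mu> x s
       = coast_dist' \<mu> x s *\<^sub>R coast_pos' \<mu> x s"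
    and coast_laplace: "coast_pos'' \<mu> x s
       = - (freq \<mu> x)\<^sup>2 *\<^sub>R coast_pos \<mu> x s - laplace_vec \<mu> x"
proof -
  obtain r v where rv: "x = (r, v)" by (cases x)
  \<comment> \<open>In these variables the equations become polynomial identities, once multiplied by powers of \<open>w\<close>.\<close>
  define d k q w c z where defs: "d = norm r" "k = \<mu> / norm r" "q = r \<bullet> v" "w = freq \<mu> x"
    "c = cos (w * s)" "z = sin (w * s)"
  have d: "d > 0" using x rv by (simp add: periodic_region_def defs)
  have w: "w > 0" using freq_pos[OF x] by (simp add: defs)
  have mu_eq: "\<mu> = k * d" using d by (simp add: defs)
  have E: "energy \<mu> x < 0" using x by (simp add: periodic_region_def)
  have "w\<^sup>2 = - 2 * energy \<mu> x" using E by (simp add: defs freq_def)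
  then have w2: "w\<^sup>2 = 2 * k - v \<bullet> v"
    by (simp add: defs rv energy_def power2_norm_eq_inner)
  then have inn: "r \<bullet> r = d\<^sup>2" "v \<bullet> v = 2 * k - w\<^sup>2" "v \<bullet> r = q" "r \<bullet> v = q"
    by (simp_all add: defs power2_norm_eq_inner inner_commute)
  have cz: "c\<^sup>2 + z\<^sup>2 = 1" by (simp add: defs)
  have p: "w\<^sup>2 *\<^sub>R coast_pos \<mu> x s = (w\<^sup>2 - k * (1 - c)) *\<^sub>R r + (d * w * z + q * (1 - c)) *\<^sub>R v"
  proof -
    have "coast_pos \<mu> x s = (1 - k / w\<^sup>2 * (1 - c)) *\<^sub>R r + (d / w * z + q / w\<^sup>2 * (1 - c)) *\<^sub>R v"
      by (simp add: coast_pos_def rv Let_def defs)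
    moreover have "w\<^sup>2 * (1 - k / w\<^sup>2 * (1 - c)) = w\<^sup>2 - k * (1 - c)"
      "w\<^sup>2 * (d / w * z + q / w\<^sup>2 * (1 - c)) = d * w * z + q * (1 - c)"
      using w by (simp_all add: field_simps power2_eq_square)
    ultimately show ?thesis by (simp only: scaleR_add_right scaleR_scaleR)
  qed
  have p1: "w *\<^sub>R coast_pos' \<mu> x s = (- k * z) *\<^sub>R r + (d * w * c + q * z) *\<^sub>R v"
  proof -
    have "coast_pos' \<mu> x s = (- k / w * z) *\<^sub>R r + (d * c + q / w * z) *\<^sub>R v"
      by (simp add: coast_pos'_def rv Let_def defs)
    moreover have "w * (- k / w * z) = - k * z" "w * (d * c + q / w * z) = d * w * c + q * z"
      using w by (simp_all add: field_simps)
    ultimately show ?thesis by (simp only: scaleR_add_right scaleR_scaleR)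
  qed
  have p2: "coast_pos'' \<mu> x s = (- k * c) *\<^sub>R r + (q * c - w * d * z) *\<^sub>R v"
    by (simp add: coast_pos''_def rv Let_def defs)
  have D: "w\<^sup>2 * coast_dist \<mu> x s = k * d + (w\<^sup>2 * d - k * d) * c + w * q * z"
  proof -
    have "coast_dist \<mu> x s = \<mu> / w\<^sup>2 + (d - \<mu> / w\<^sup>2) * c + q / w * z"
      by (simp add: coast_dist_def rv Let_def defs(1,3-))
    then show ?thesis using w by (simp add: mu_eq field_simps power2_eq_square)
  qed
  have D1: "w * coast_dist' \<mu> x s = - (w\<^sup>2 * d - k * d) * z + w * q * c"
  proof -
    have "coast_dist' \<mu> x s = - w * (d - \<mu> / w\<^sup>2) * z + q * c"
      by (simp add: coast_dist'_def rv Let_def defs(1,3-))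
    moreover have "w * (w * (d - \<mu> / w\<^sup>2)) = w\<^sup>2 * d - k * d"
      using w by (simp add: mu_eq field_simps power2_eq_square)
    ultimately show ?thesis by algebra
  qed
  have L: "laplace_vec \<mu> x = (k - w\<^sup>2) *\<^sub>R r - q *\<^sub>R v"
    by (simp add: rv laplace_vec_eq power2_norm_eq_inner inn mu_eq)
       (use d in \<open>simp add: defs\<close>)
  show pos: "coast_dist \<mu> x s > 0"
  proof -
    have "0 < (norm (ang_mom x))\<^sup>2" using x by (simp add: periodic_region_def)
    also have "\<dots> = d\<^sup>2 * (2 * k - w\<^sup>2) - q\<^sup>2"
      unfolding rv norm_ang_mom unfolding power2_norm_eq_inner inn ..
    finally have "0 < w\<^sup>2 * (d\<^sup>2 * (2 * k - w\<^sup>2) - q\<^sup>2)" using w by simp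
    \<comment> \<open>The squared amplitude of the oscillation of the distance is below the square of its mean.\<close>
    then have lt: "(w\<^sup>2 * d - k * d)\<^sup>2 + (w * q)\<^sup>2 < (k * d)\<^sup>2"
      by (simp add: algebra_simps power2_eq_square)
    have "((w\<^sup>2 * d - k * d) * c + w * q * z)\<^sup>2
       \<le> ((w\<^sup>2 * d - k * d) * c + w * q * z)\<^sup>2 + ((w\<^sup>2 * d - k * d) * z - w * q * c)\<^sup>2"
      by simp
    also have "\<dots> = ((w\<^sup>2 * d - k * d)\<^sup>2 + (w * q)\<^sup>2) * (c\<^sup>2 + z\<^sup>2)"
      by (simp add: algebra_simps power2_eq_square)
    also have "\<dots> < (k * d)\<^sup>2"
      using lt by (simp only: cz mult_1_right)
    finally have "((w\<^sup>2 * d - k * d) * c + w * q * z)\<^sup>2 < (k * d)\<^sup>2" .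
    then have "\<bar>(w\<^sup>2 * d - k * d) * c + w * q * z\<bar> < k * d"
      using mu mu_eq by (metis abs_le_square_iff abs_of_pos not_less)
    then have "w\<^sup>2 * coast_dist \<mu> x s > 0" unfolding D by linarith
    then show ?thesis using w by (simp add: zero_less_mult_iff)
  qed
  have "(w\<^sup>2 *\<^sub>R coast_pos \<mu> x s) \<bullet> (w\<^sup>2 *\<^sub>R coast_pos \<mu> x s) = (w\<^sup>2 * coast_dist \<mu> x s)\<^sup>2"
    unfolding p D using cz
    by (simp add: inner_add_left inner_add_right inn del: scaleR_left_diff_distrib) algebra
  then have "(w\<^sup>2 * w\<^sup>2) * (coast_pos \<mu> x s \<bullet> coast_pos \<mu> x s) = (w\<^sup>2 * w\<^sup>2) * (coast_dist \<mu> x s)\<^sup>2"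
    by (simp add: power2_eq_square algebra_simps)
  then have "(norm (coast_pos \<mu> x s))\<^sup>2 = (coast_dist \<mu> x s)\<^sup>2"
    using w by (simp add: power2_norm_eq_inner)
  then show "norm (coast_pos \<mu> x s) = coast_dist \<mu> x s"
    using pos by (simp add: power2_eq_iff_nonneg)
  show lap: "coast_pos'' \<mu> x s = - (freq \<mu> x)\<^sup>2 *\<^sub>R coast_pos \<mu> x s - laplace_vec \<mu> x"
    using p unfolding L p2 by (simp flip: defs) (simp add: algebra_simps)
  have coef: "k * d * (w\<^sup>2 - k * (1 - c)) + (k * d + (w\<^sup>2 * d - k * d) * c + w * q * z) * (- k * c)
      = (- (w\<^sup>2 * d - k * d) * z + w * q * c) * (- k * z)"
    "k * d * (d * w * z + q * (1 - c)) + (k * d + (w\<^sup>2 * d - k * d) * c + w * q * z) * (q * c - w * d * z)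
      = (- (w\<^sup>2 * d - k * d) * z + w * q * c) * (d * w * c + q * z)"
    using cz by algebra+
  have comb: "l *\<^sub>R (a *\<^sub>R r + b *\<^sub>R v) + m *\<^sub>R (a' *\<^sub>R r + b' *\<^sub>R v)
      = (l * a + m * a') *\<^sub>R r + (l * b + m * b') *\<^sub>R v" for l m a a' b b' :: real
    by (simp add: algebra_simps)
  have "w\<^sup>2 *\<^sub>R (\<mu> *\<^sub>R coast_pos \<mu> x s + coast_dist \<mu> x s *\<^sub>R coast_pos'' \<mu> x s)
     = (k * d) *\<^sub>R (w\<^sup>2 *\<^sub>R coast_pos \<mu> x s) + (w\<^sup>2 * coast_dist \<mu> x s) *\<^sub>R coast_pos'' \<mu> x s"
    by (simp add: mu_eq algebra_simps)
  also have "\<dots> = (k * d * (w\<^sup>2 - k * (1 - c)) + (k * d + (w\<^sup>2 * d - k * d) * c + w * q * z) * (- k * c)) *\<^sub>R r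
     + (k * d * (d * w * z + q * (1 - c)) + (k * d + (w\<^sup>2 * d - k * d) * c + w * q * z) * (q * c - w * d * z)) *\<^sub>R v"
    unfolding p D p2 comb ..
  also have "\<dots> = (w * coast_dist' \<mu> x s) *\<^sub>R (w *\<^sub>R coast_pos' \<mu> x s)"
    unfolding coef D1 p1 scaleR_add_right scaleR_scaleR by simp
  also have "\<dots> = w\<^sup>2 *\<^sub>R (coast_dist' \<mu> x s *\<^sub>R coast_pos' \<mu> x s)"
    by (simp add: power2_eq_square algebra_simps)
  finally show "\<mu> *\<^sub>R coast_pos \<mu> x s + coast_dist \<mu> x s *\<^sub>R coast_pos'' \<mu> x s
       = coast_dist' \<mu> x s *\<^sub>R coast_pos' \<mu> x s"
    by (rule scaleR_left_imp_eq[rotated]) (use w in simp)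
qed

text \<open>The first equation differentiates \<open>R \<bullet> R = d\<^sup>2\<close>. The second is conservation of energy; it combines
  the derivative of the first with the inner product of \<open>R\<close> and Newton's equation.\<close>

lemma
  assumes mu: "\<mu> > 0" and x: "x \<in> periodic_region \<mu>"
  shows inner_coast_pos': "coast_pos \<mu> x s \<bullet> coast_pos' \<mu> x s = coast_dist \<mu> x s * coast_dist' \<mu> x s"
    and norm_coast_pos': "(norm (coast_pos' \<mu> x s))\<^sup>2
       = 2 * \<mu> * coast_dist \<mu> x s - (freq \<mu> x)\<^sup>2 * (coast_dist \<mu> x s)\<^sup>2"
proof -
  let ?R = "coast_pos \<mu> x" and ?R1 = "coast_pos' \<mu> x" and ?R2 = "coast_pos'' \<mu> x"
  let ?d = "coast_dist \<mu> x" and ?d1 = "coast_dist' \<mu> x" and ?w = "freq \<mu> x"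
  have hvR: "(?R has_derivative (\<lambda>h. h *\<^sub>R ?R1 s)) (at s)"
    and hvR1: "(?R1 has_derivative (\<lambda>h. h *\<^sub>R ?R2 s)) (at s)" for s
    using has_derivative_coast_pos[OF x, of s UNIV] has_derivative_coast_pos'[OF x, of s UNIV]
    by (simp_all add: has_vector_derivative_def)
  have RR: "?R s \<bullet> ?R s = (?d s)\<^sup>2" for s
    by (simp add: norm_coast_pos[OF mu x] flip: power2_norm_eq_inner)
  have 1: "?R s \<bullet> ?R1 s = ?d s * ?d1 s" for s
  proof -
    have "((\<lambda>s. ?R s \<bullet> ?R s) has_real_derivative 2 * (?R s \<bullet> ?R1 s)) (at s)"
      by (auto simp: has_field_derivative_def inner_commute intro!: derivative_eq_intros hvR ext)
    moreover have "((\<lambda>s. (?d s)\<^sup>2) has_real_derivative 2 * (?d s * ?d1 s)) (at s)"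
      using has_derivative_coast_dist[OF x, of s UNIV] by (auto intro!: derivative_eq_intros)
    ultimately show ?thesis unfolding RR using DERIV_unique by fastforce
  qed
  then show "?R s \<bullet> ?R1 s = ?d s * ?d1 s" .
  have "((\<lambda>s. ?R s \<bullet> ?R1 s) has_real_derivative ?R1 s \<bullet> ?R1 s + ?R s \<bullet> ?R2 s) (at s)"
    by (auto simp: has_field_derivative_def inner_commute algebra_simps
        intro!: derivative_eq_intros hvR hvR1 ext)
  moreover have "((\<lambda>s. ?d s * ?d1 s) has_real_derivative ?d1 s * ?d1 s + ?d s * (\<mu> - ?w\<^sup>2 * ?d s)) (at s)"
    using has_derivative_coast_dist[OF x, of s UNIV] has_derivative_coast_dist'[OF x, of s UNIV]
    by (auto intro!: derivative_eq_intros)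
  ultimately have 2: "?R1 s \<bullet> ?R1 s + ?R s \<bullet> ?R2 s = ?d1 s * ?d1 s + ?d s * (\<mu> - ?w\<^sup>2 * ?d s)"
    unfolding 1 using DERIV_unique by fastforce
  have "?R s \<bullet> (\<mu> *\<^sub>R ?R s + ?d s *\<^sub>R ?R2 s) = ?R s \<bullet> (?d1 s *\<^sub>R ?R1 s)"
    by (simp only: coast_pos_ode[OF mu x])
  then have "?d s * (\<mu> * ?d s + ?R s \<bullet> ?R2 s) = ?d s * (?d1 s * ?d1 s)"
    by (simp add: inner_add_right RR 1 power2_eq_square algebra_simps)
  then have "\<mu> * ?d s + ?R s \<bullet> ?R2 s = ?d1 s * ?d1 s"
    using coast_dist_pos[OF mu x, of s] by simp
  with 2 show "(norm (?R1 s))\<^sup>2 = 2 * \<mu> * ?d s - ?w\<^sup>2 * (?d s)\<^sup>2"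
    unfolding power2_norm_eq_inner by (simp add: power2_eq_square algebra_simps)
qed

text \<open>The angular momentum is treated last, since its length is a function of the other two quantities
  by \<open>norm_laplace_vec\<close>.\<close>

lemma
  assumes mu: "\<mu> > 0" and x: "x \<in> periodic_region \<mu>"
  shows energy_coast: "energy \<mu> (coast \<mu> x s) = energy \<mu> x"
    and laplace_vec_coast: "laplace_vec \<mu> (coast \<mu> x s) = laplace_vec \<mu> x"
    and norm_ang_mom_coast: "norm (ang_mom (coast \<mu> x s)) = norm (ang_mom x)"
    and fst_coast_nonzero: "fst (coast \<mu> x s) \<noteq> 0"
proof -
  let ?R = "coast_pos \<mu> x s" and ?R1 = "coast_pos' \<mu> x s" and ?R2 = "coast_pos'' \<mu> x s"
  define d d1 w where defs: "d = coast_dist \<mu> x s" "d1 = coast_dist' \<mu> x s" "w = freq \<mu> x"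
  have d: "d > 0" using coast_dist_pos[OF mu x] by (simp add: defs)
  have E: "energy \<mu> x < 0" and x0: "fst x \<noteq> 0" using x by (auto simp: periodic_region_def)
  have nR: "norm ?R = d" using norm_coast_pos[OF mu x] by (simp add: defs)
  have V: "(norm ((1 / d) *\<^sub>R ?R1))\<^sup>2 = 2 * \<mu> / d - w\<^sup>2"
    using norm_coast_pos'[OF mu x, of s] d
    by (simp add: power_mult_distrib power_divide flip: defs) (simp add: field_simps power2_eq_square)
  have ww: "w\<^sup>2 = - 2 * energy \<mu> x" using E by (simp add: defs freq_def)
  show en: "energy \<mu> (coast \<mu> x s) = energy \<mu> x"
  proof -
    have "energy \<mu> (coast \<mu> x s) = (norm ((1 / d) *\<^sub>R ?R1))\<^sup>2 / 2 - \<mu> / d"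
      by (simp add: energy_def coast_def nR)
    then show ?thesis unfolding V ww by (simp add: add_divide_distrib)
  qed
  have RV: "?R \<bullet> ((1 / d) *\<^sub>R ?R1) = d1"
    using inner_coast_pos'[OF mu x, of s] d by (simp flip: defs)
  have "d *\<^sub>R laplace_vec \<mu> (coast \<mu> x s) = (\<mu> - d * w\<^sup>2) *\<^sub>R ?R - d1 *\<^sub>R ?R1"
  proof -
    have "d * (2 * \<mu> / d - w\<^sup>2 - \<mu> / d) = \<mu> - d * w\<^sup>2" "d * (d1 * (1 / d)) = d1"
      using d by (simp_all add: field_simps)
    then show ?thesis
      unfolding coast_def nR laplace_vec_eq V RV by (simp only: scaleR_diff_right scaleR_scaleR)
  qed
  also have "\<dots> = d *\<^sub>R laplace_vec \<mu> x"
    using coast_pos_ode[OF mu x, of s, symmetric] coast_laplace[OF mu x, of s]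
    by (simp flip: defs) (simp add: algebra_simps)
  finally show lap: "laplace_vec \<mu> (coast \<mu> x s) = laplace_vec \<mu> x" using d by simp
  show nz: "fst (coast \<mu> x s) \<noteq> 0" using nR d by (auto simp: coast_def)
  have "2 * energy \<mu> (coast \<mu> x s) * (norm (ang_mom (coast \<mu> x s)))\<^sup>2
      = 2 * energy \<mu> x * (norm (ang_mom x))\<^sup>2"
    using norm_laplace_vec[of "fst (coast \<mu> x s)" \<mu> "snd (coast \<mu> x s)"] nz lap
      norm_laplace_vec[of "fst x" \<mu> "snd x"] x0 by simp
  then show "norm (ang_mom (coast \<mu> x s)) = norm (ang_mom x)"
    using E by (simp add: en)
qed

lemma coast_in_stable:
  assumes mu: "\<mu> > 0" and x: "x \<in> stable_periodic_region \<mu> r\<^sub>c"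
  shows "coast \<mu> x s \<in> stable_periodic_region \<mu> r\<^sub>c"
proof -
  have x': "x \<in> periodic_region \<mu>" using x by (simp add: stable_periodic_region_def)
  note c = energy_coast[OF mu x'] laplace_vec_coast[OF mu x'] norm_ang_mom_coast[OF mu x']
    fst_coast_nonzero[OF mu x']
  have "ang_mom (coast \<mu> x s) \<noteq> 0" 
    using c(3)[of s] x' by (auto simp: periodic_region_def)
  then show ?thesis using x c
    by (simp add: stable_periodic_region_def periodic_region_def perigee_def eccentricity_def)
qed

section \<open>Trajectories from curves in fictitious time\<close>

text \<open>A class of trajectories that is convenient to concatenate: Lipschitz curves that satisfy the
  equation off a finite set, with a control that is Borel measurable on the whole line. States
  include the mass, so that the system is autonomous and pieces can be shifted in time.\<close>

definition transfer ::
    "real \<Rightarrow> real \<Rightarrow> real \<Rightarrow> real \<Rightarrow> orbit_state \<times> real \<Rightarrow> orbit_state \<times> real \<Rightarrow> bool" where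
  "transfer \<mu> \<beta> r\<^sub>c \<tau>max z z' \<longleftrightarrow>
     (\<exists>T\<ge>0. \<exists>\<tau> Z N C. \<tau> \<in> borel_measurable borel \<and> (\<forall>t. norm (\<tau> t) \<le> \<tau>max) \<and>
        Z 0 = z \<and> Z T = z' \<and> C-lipschitz_on {0..T} Z \<and>
        (\<forall>t\<in>{0..T}. fst (Z t) \<in> admissible_region \<mu> r\<^sub>c \<and> snd (Z t) > 0) \<and>
        finite N \<and>
        (\<forall>t\<in>{0<..<T} - N. (Z has_vector_derivative sat_field \<mu> \<beta> (\<tau> t) (Z t)) (at t)))"

lemma transfer_trans:
  assumes "transfer \<mu> \<beta> r\<^sub>c \<tau>max z z'" "transfer \<mu> \<beta> r\<^sub>c \<tau>max z' z''"
  shows "transfer \<mu> \<beta> r\<^sub>c \<tau>max z z''"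
proof -
  obtain T1 \<tau>1 Z1 N1 C1 where 1: "T1 \<ge> 0" "\<tau>1 \<in> borel_measurable borel" "\<forall>t. norm (\<tau>1 t) \<le> \<tau>max"
    "Z1 0 = z" "Z1 T1 = z'" "C1-lipschitz_on {0..T1} Z1"
    "\<forall>t\<in>{0..T1}. fst (Z1 t) \<in> admissible_region \<mu> r\<^sub>c \<and> snd (Z1 t) > 0" "finite N1"
    "\<forall>t\<in>{0<..<T1} - N1. (Z1 has_vector_derivative sat_field \<mu> \<beta> (\<tau>1 t) (Z1 t)) (at t)"
    using assms(1) unfolding transfer_def by blast
  obtain T2 \<tau>2 Z2 N2 C2 where 2: "T2 \<ge> 0" "\<tau>2 \<in> borel_measurable borel" "\<forall>t. norm (\<tau>2 t) \<le> \<tau>max"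
    "Z2 0 = z'" "Z2 T2 = z''" "C2-lipschitz_on {0..T2} Z2"
    "\<forall>t\<in>{0..T2}. fst (Z2 t) \<in> admissible_region \<mu> r\<^sub>c \<and> snd (Z2 t) > 0" "finite N2"
    "\<forall>t\<in>{0<..<T2} - N2. (Z2 has_vector_derivative sat_field \<mu> \<beta> (\<tau>2 t) (Z2 t)) (at t)"
    using assms(2) unfolding transfer_def by blast
  define Z where "Z t = (if t \<le> T1 then Z1 t else Z2 (t - T1))" for t
  define \<tau> where "\<tau> t = (if t \<le> T1 then \<tau>1 t else \<tau>2 (t - T1))" for t
  define N where "N = N1 \<union> {T1} \<union> (\<lambda>t. t + T1) ` N2"
  have "\<tau> \<in> borel_measurable borel"
    unfolding \<tau>_def using 1(2) 2(2) by measurable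
  moreover have "norm (\<tau> t) \<le> \<tau>max" for t using 1(3) 2(3) by (simp add: \<tau>_def)
  moreover have "Z 0 = z" "Z (T1 + T2) = z''"
    using 1 2 by (auto simp: Z_def)
  moreover have "(max C1 C2)-lipschitz_on {0..T1 + T2} Z"
    unfolding Z_def[abs_def]
  proof (rule lipschitz_on_concat_max[OF 1(6)])
    have "(C2 * 1)-lipschitz_on {T1..T1 + T2} (\<lambda>t. Z2 (t - T1))"
    proof (rule lipschitz_on_compose2[where f = "\<lambda>t. t - T1" and g = Z2])
      show "1-lipschitz_on {T1..T1 + T2} (\<lambda>t. t - T1)"
        by (rule lipschitz_onI) (auto simp: dist_real_def)
      show "C2-lipschitz_on ((\<lambda>t. t - T1) ` {T1..T1 + T2}) Z2"
        by (rule lipschitz_on_subset[OF 2(6)]) auto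
    qed
    then show "C2-lipschitz_on {T1..T1 + T2} (\<lambda>t. Z2 (t - T1))" by simp
    show "Z1 T1 = Z2 (T1 - T1)" using 1 2 by simp
  qed
  moreover have "fst (Z t) \<in> admissible_region \<mu> r\<^sub>c \<and> snd (Z t) > 0" if "t \<in> {0..T1 + T2}" for t
    using that 1(7) 2(7) by (auto simp: Z_def)
  moreover have "finite N" using 1 2 by (simp add: N_def)
  moreover have "(Z has_vector_derivative sat_field \<mu> \<beta> (\<tau> t) (Z t)) (at t)"
    if t: "t \<in> {0<..<T1 + T2} - N" for t
  proof (cases "t < T1")
    case True
    then have "(Z1 has_vector_derivative sat_field \<mu> \<beta> (\<tau> t) (Z t)) (at t)"
      using t 1(9) by (auto simp: Z_def \<tau>_def N_def)
    then show ?thesis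
      by (rule has_vector_derivative_transform_within_open[where S = "{..<T1}"])
         (use True in \<open>auto simp: Z_def\<close>)
  next
    case False
    then have gt: "t > T1" using t by (auto simp: N_def)
    have "t - T1 \<notin> N2" using t by (force simp: N_def)
    then have "(Z2 has_vector_derivative sat_field \<mu> \<beta> (\<tau> t) (Z t)) (at (t - T1))"
      using gt t 2(9) by (auto simp: Z_def \<tau>_def)
    moreover have "((\<lambda>t. t - T1) has_vector_derivative 1) (at t)"
      by (auto intro!: derivative_eq_intros)
    ultimately have "((Z2 \<circ> (\<lambda>t. t - T1)) has_vector_derivative 1 *\<^sub>R sat_field \<mu> \<beta> (\<tau> t) (Z t)) (at t)"
      using vector_diff_chain_at by blast
    then have "((Z2 \<circ> (\<lambda>t. t - T1)) has_vector_derivative sat_field \<mu> \<beta> (\<tau> t) (Z t)) (at t)"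
      by simp
    then show ?thesis
      by (rule has_vector_derivative_transform_within_open[where S = "{T1<..}"])
         (use gt in \<open>auto simp: Z_def\<close>)
  qed
  ultimately show ?thesis
    using \<open>T1 \<ge> 0\<close> \<open>T2 \<ge> 0\<close> unfolding transfer_def
    by (intro exI[of _ "T1 + T2"] conjI exI[of _ \<tau>] exI[of _ Z] exI[of _ N] exI[of _ "max C1 C2"]) auto
qed

lemma lipschitz_on_of_continuous_derivative:
  fixes Z :: "real \<Rightarrow> 'a::real_normed_vector"
  assumes Z: "\<And>s. s \<in> {a..b} \<Longrightarrow> (Z has_vector_derivative Z' s) (at s within {a..b})"
    and Z': "continuous_on {a..b} Z'"
  shows "\<exists>C. C-lipschitz_on {a..b} Z"
proof -
  have "bounded (Z' ` {a..b})"
    by (intro compact_imp_bounded compact_continuous_image Z') simp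
  then obtain B where B: "B > 0" "\<And>s. s \<in> {a..b} \<Longrightarrow> norm (Z' s) \<le> B"
    by (auto simp: bounded_pos)
  have "B-lipschitz_on {a..b} Z"
  proof (rule lipschitz_onI)
    fix x y assume "x \<in> {a..b}" "y \<in> {a..b}"
    then show "dist (Z x) (Z y) \<le> B * dist x y"
      unfolding dist_norm
      by (intro differentiable_bound[where S = "{a..b}" and f' = "\<lambda>s h. h *\<^sub>R Z' s"])
         (use Z B in \<open>auto simp: has_vector_derivative_def onorm_scaleR_left onorm_id\<close>)
  qed (use B in simp)
  then show ?thesis by blast
qed

text \<open>The physical time \<open>\<integral> \<rho> ds\<close> grows at a rate bounded below by the minimum of \<open>\<rho>\<close>, so its inverse \<open>\<theta>\<close> is
  Lipschitz, with derivative \<open>1 / \<rho>\<close> at interior points.\<close>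

lemma time_change:
  fixes Z :: "real \<Rightarrow> 'a::real_normed_vector"
  assumes ab: "a \<le> b"
    and Z: "\<And>s. s \<in> {a..b} \<Longrightarrow> (Z has_vector_derivative \<rho> s *\<^sub>R f s) (at s within {a..b})"
    and \<rho>: "continuous_on {a..b} \<rho>" and f: "continuous_on {a..b} f"
    and pos: "\<And>s. s \<in> {a..b} \<Longrightarrow> \<rho> s > 0"
  obtains T \<theta> C where "T \<ge> 0" "continuous_on {0..T} \<theta>" "\<theta> ` {0..T} \<subseteq> {a..b}"
    "\<theta> 0 = a" "\<theta> T = b" "C-lipschitz_on {0..T} (Z \<circ> \<theta>)"
    "\<And>t. t \<in> {0<..<T} \<Longrightarrow> ((Z \<circ> \<theta>) has_vector_derivative f (\<theta> t)) (at t)"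
proof -
  define clock where "clock s = integral {a..s} \<rho>" for s
  have der: "(clock has_real_derivative \<rho> s) (at s within {a..b})" if "s \<in> {a..b}" for s
    unfolding clock_def[abs_def] by (rule integral_has_real_derivative[OF \<rho> that])
  have cont: "continuous_on {a..b} clock"
    using DERIV_continuous[OF der] by (auto simp: continuous_on_eq_continuous_within)
  obtain s0 where s0: "s0 \<in> {a..b}" "\<And>s. s \<in> {a..b} \<Longrightarrow> \<rho> s0 \<le> \<rho> s"
    using continuous_attains_inf[OF _ _ \<rho>] ab by fastforce
  define c where "c = \<rho> s0"
  have c: "c > 0" using pos s0 by (simp add: c_def)
  have inc: "c * (s' - s) \<le> clock s' - clock s" if "s \<in> {a..b}" "s' \<in> {a..b}" "s \<le> s'" for s s'
  proof -
    have int: "\<rho> integrable_on {s..s'}" "\<rho> integrable_on {a..s'}"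
      using that by (auto intro!: integrable_continuous_real continuous_on_subset[OF \<rho>])
    have "integral {a..s} \<rho> + integral {s..s'} \<rho> = integral {a..s'} \<rho>"
      by (rule Henstock_Kurzweil_Integration.integral_combine) (use that int in auto)
    then have "clock s' - clock s = integral {s..s'} \<rho>"
      by (simp add: clock_def)
    moreover have "integral {s..s'} (\<lambda>_. c) \<le> integral {s..s'} \<rho>"
      using that s0(2) int by (intro integral_le) (auto simp: c_def)
    ultimately show ?thesis using that by (simp add: mult.commute)
  qed
  define T where "T = clock b"
  have T: "T \<ge> 0" using inc[of a b] ab c mult_nonneg_nonneg[of c "b - a"]
    by (simp add: T_def clock_def del: mult_nonneg_nonneg)
  have clock0: "clock a = 0" by (simp add: clock_def)
  have inj: "s = s'" if "clock s = clock s'" "s \<in> {a..b}" "s' \<in> {a..b}" for s s'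
    using inc[of s s'] inc[of s' s] that c by (smt (verit) mult_pos_pos)
  have surj: "\<exists>s\<in>{a..b}. clock s = t" if "t \<in> {0..T}" for t
    using IVT'[of clock a t b] that cont ab by (auto simp: clock0 T_def)
  define \<theta> where "\<theta> t = (SOME s. s \<in> {a..b} \<and> clock s = t)" for t
  have \<theta>: "\<theta> t \<in> {a..b}" "clock (\<theta> t) = t" if "t \<in> {0..T}" for t
    using someI_ex[of "\<lambda>s. s \<in> {a..b} \<and> clock s = t"] surj[OF that] unfolding \<theta>_def by blast+
  have \<theta>ab: "\<theta> 0 = a" "\<theta> T = b"
    using inj[of "\<theta> 0" a] inj[of "\<theta> T" b] \<theta>[of 0] \<theta>[of T] T ab by (auto simp: clock0 T_def)
  have \<theta>lip: "(1 / c)-lipschitz_on {0..T} \<theta>"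
  proof (rule lipschitz_onI)
    fix t t' assume t: "t \<in> {0..T}" "t' \<in> {0..T}"
    have "c * \<bar>\<theta> t - \<theta> t'\<bar> \<le> \<bar>t - t'\<bar>"
      using inc[of "\<theta> t" "\<theta> t'"] inc[of "\<theta> t'" "\<theta> t"] \<theta>[OF t(1)] \<theta>[OF t(2)]
      by (cases "\<theta> t \<le> \<theta> t'") auto
    then show "dist (\<theta> t) (\<theta> t') \<le> 1 / c * dist t t'"
      using c by (simp add: dist_real_def field_simps)
  qed (use c in simp)
  then have \<theta>cont: "continuous_on {0..T} \<theta>" by (rule lipschitz_on_continuous_on)
  have sub: "\<theta> ` {0..T} \<subseteq> {a..b}" using \<theta> by auto
  have "continuous_on {a..b} (\<lambda>s. \<rho> s *\<^sub>R f s)" by (intro continuous_intros \<rho> f)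
  then obtain C where C: "C-lipschitz_on {a..b} Z"
    using lipschitz_on_of_continuous_derivative[of a b Z "\<lambda>s. \<rho> s *\<^sub>R f s"] Z by auto
  have lip: "(C * (1 / c))-lipschitz_on {0..T} (Z \<circ> \<theta>)"
    by (rule lipschitz_on_compose[OF \<theta>lip lipschitz_on_subset[OF C sub]])
  have "((Z \<circ> \<theta>) has_vector_derivative f (\<theta> t)) (at t)" if t: "t \<in> {0<..<T}" for t
  proof -
    have tt: "t \<in> {0..T}" using t by auto
    have "clock (\<theta> t) \<noteq> clock a" "clock (\<theta> t) \<noteq> clock b"
      using \<theta>(2)[OF tt] t by (simp_all add: clock0 flip: T_def)
    then have "\<theta> t \<noteq> a" "\<theta> t \<noteq> b" by metis+
    then have in1: "\<theta> t \<in> {a<..<b}" using \<theta>(1)[OF tt] by auto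
    then have at: "at (\<theta> t) within {a..b} = at (\<theta> t)"
      by (intro at_within_interior) auto
    have "(\<theta> has_real_derivative inverse (\<rho> (\<theta> t))) (at t)"
    proof (rule DERIV_inverse_function[where f = clock and a = 0 and b = T])
      show "(clock has_real_derivative \<rho> (\<theta> t)) (at (\<theta> t))" using der[of "\<theta> t"] \<theta>[OF tt] at by auto
      show "\<rho> (\<theta> t) \<noteq> 0" using pos \<theta>[OF tt] by fastforce
      show "isCont \<theta> t" using \<theta>cont t continuous_on_interior[of "{0..T}" \<theta> t] by auto
    qed (use t \<theta> in auto)
    then have "(\<theta> has_vector_derivative inverse (\<rho> (\<theta> t))) (at t)"
      by (simp add: has_real_derivative_iff_has_vector_derivative)
    moreover have "(Z has_vector_derivative \<rho> (\<theta> t) *\<^sub>R f (\<theta> t)) (at (\<theta> t))"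
      using Z[of "\<theta> t"] \<theta>[OF tt] at by auto
    ultimately have "((Z \<circ> \<theta>) has_vector_derivative inverse (\<rho> (\<theta> t)) *\<^sub>R \<rho> (\<theta> t) *\<^sub>R f (\<theta> t)) (at t)"
      by (rule vector_diff_chain_at)
    moreover have "\<rho> (\<theta> t) > 0" using pos \<theta>[OF tt] by simp
    ultimately show ?thesis by simp
  qed
  with T \<theta>cont sub \<theta>ab lip show ?thesis by (rule that)
qed

text \<open>The acceleration, in excess of gravity, along a curve given with two derivatives in the fictitious
  time: with \<open>V = R' / norm R\<close> it is \<open>V' / norm R + (\<mu> / norm R ^ 3) *\<^sub>R R\<close>.\<close>

definition required_acc :: "real \<Rightarrow> real ^ 3 \<Rightarrow> real ^ 3 \<Rightarrow> real ^ 3 \<Rightarrow> real ^ 3" where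
  "required_acc \<mu> R R' R'' =
     (1 / (norm R)\<^sup>2) *\<^sub>R R'' - (R \<bullet> R' / norm R ^ 4) *\<^sub>R R' + (\<mu> / norm R ^ 3) *\<^sub>R R"

text \<open>Any curve can be flown with the thrust \<open>M u\<close>, where \<open>u\<close> is the required acceleration and
  \<open>M = m exp (- \<beta> \<integral> norm R * norm u ds)\<close> is the resulting mass. As \<open>0 < M \<le> m\<close>, bounding the thrust
  computed with the initial mass is sufficient.\<close>

lemma curve_transfer:
  fixes R R' R'' :: "real \<Rightarrow> real ^ 3"
  assumes "\<beta> \<ge> 0" and ab: "a \<le> b" and m: "m > 0"
    and R: "\<And>s. s \<in> {a..b} \<Longrightarrow> (R has_vector_derivative R' s) (at s within {a..b})"
    and R': "\<And>s. s \<in> {a..b} \<Longrightarrow> (R' has_vector_derivative R'' s) (at s within {a..b})"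
    and R'': "continuous_on {a..b} R''"
    and adm: "\<And>s. s \<in> {a..b} \<Longrightarrow> (R s, (1 / norm (R s)) *\<^sub>R R' s) \<in> admissible_region \<mu> r\<^sub>c"
    and acc: "\<And>s. s \<in> {a..b} \<Longrightarrow> m * norm (required_acc \<mu> (R s) (R' s) (R'' s)) \<le> \<tau>max"
  shows "\<exists>m'. 0 < m' \<and> m' \<le> m \<and> transfer \<mu> \<beta> r\<^sub>c \<tau>max
     ((R a, (1 / norm (R a)) *\<^sub>R R' a), m) ((R b, (1 / norm (R b)) *\<^sub>R R' b), m')"
proof -
  define \<rho> where "\<rho> s = norm (R s)" for s
  define u where "u s = required_acc \<mu> (R s) (R' s) (R'' s)" for s
  define J where "J s = integral {a..s} (\<lambda>s. \<rho> s * norm (u s))" for s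
  define M where "M s = m * exp (- \<beta> * J s)" for s
  define \<tau> where "\<tau> s = M s *\<^sub>R u s" for s
  define Z where "Z s = ((R s, (1 / \<rho> s) *\<^sub>R R' s), M s)" for s
  define f where "f s = sat_field \<mu> \<beta> (\<tau> s) (Z s)" for s
  have R0: "R s \<noteq> 0" if "s \<in> {a..b}" for s
    using adm[OF that] by (simp add: admissible_region_def periodic_region_def)
  have cR: "continuous_on {a..b} R" "continuous_on {a..b} R'"
    using has_vector_derivative_continuous[OF R] has_vector_derivative_continuous[OF R']
    by (auto simp: continuous_on_eq_continuous_within)
  have c\<rho>: "continuous_on {a..b} \<rho>" unfolding \<rho>_def by (intro continuous_intros cR)
  have cu: "continuous_on {a..b} u"
    unfolding u_def required_acc_def by (intro continuous_intros cR R'') (use R0 in auto)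
  have dJ: "(J has_real_derivative \<rho> s * norm (u s)) (at s within {a..b})" if "s \<in> {a..b}" for s
    unfolding J_def[abs_def]
    by (rule integral_has_real_derivative) (use that in \<open>auto intro!: continuous_intros c\<rho> cu\<close>)
  have dM: "(M has_real_derivative \<rho> s * (- \<beta> * norm (\<tau> s))) (at s within {a..b})"
    if "s \<in> {a..b}" for s
    unfolding M_def[abs_def] \<tau>_def using m
    by (auto intro!: derivative_eq_intros dJ[OF that] simp: M_def)
  have Mpos: "M s > 0" for s using m by (simp add: M_def)
  have cM: "continuous_on {a..b} M"
    using DERIV_continuous[OF dM] by (auto simp: continuous_on_eq_continuous_within)
  \<comment> \<open>Where the integral does not exist its value is 0.\<close>
  have J0: "J s \<ge> 0" for s
    unfolding J_def by (cases "(\<lambda>s. \<rho> s * norm (u s)) integrable_on {a..s}")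
      (auto simp: \<rho>_def not_integrable_integral intro!: integral_nonneg)
  then have Mle: "M s \<le> m" for s
    using m \<open>\<beta> \<ge> 0\<close> by (simp add: M_def)
  have \<tau>le: "norm (\<tau> s) \<le> \<tau>max" if "s \<in> {a..b}" for s
  proof -
    have "norm (\<tau> s) \<le> m * norm (u s)"
      using Mpos[of s] Mle[of s] by (simp add: \<tau>_def mult_right_mono)
    with acc[OF that] show ?thesis by (simp add: u_def)
  qed
  have d\<rho>: "(\<rho> has_real_derivative (R s \<bullet> R' s) / \<rho> s) (at s within {a..b})" if s: "s \<in> {a..b}" for s
  proof -
    have "((\<lambda>s. R s \<bullet> R s) has_real_derivative 2 * (R s \<bullet> R' s)) (at s within {a..b})"
      using R[OF s] unfolding has_vector_derivative_def has_field_derivative_def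
      by (auto intro!: derivative_eq_intros simp: inner_commute)
    then have "((\<lambda>s. sqrt (R s \<bullet> R s)) has_real_derivative
        inverse (sqrt (R s \<bullet> R s)) / 2 * (2 * (R s \<bullet> R' s))) (at s within {a..b})"
      using R0[OF s] by (intro DERIV_chain2[OF DERIV_real_sqrt]) auto
    then show ?thesis
      unfolding \<rho>_def[abs_def] norm_eq_sqrt_inner by (simp add: field_simps)
  qed
  have dZ: "(Z has_vector_derivative \<rho> s *\<^sub>R f s) (at s within {a..b})" if s: "s \<in> {a..b}" for s
  proof -
    have \<rho>: "\<rho> s \<noteq> 0" using R0[OF s] by (simp add: \<rho>_def)
    have "((\<lambda>s. 1 / \<rho> s) has_real_derivative - (R s \<bullet> R' s) / \<rho> s ^ 3) (at s within {a..b})"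
      using \<rho> by (auto intro!: derivative_eq_intros d\<rho>[OF s] simp: field_simps power3_eq_cube)
    then have "((\<lambda>s. (1 / \<rho> s) *\<^sub>R R' s) has_vector_derivative
        (1 / \<rho> s) *\<^sub>R R'' s + (- (R s \<bullet> R' s) / \<rho> s ^ 3) *\<^sub>R R' s) (at s within {a..b})"
      by (rule has_vector_derivative_scaleR[OF _ R'[OF s]])
    then have "(Z has_vector_derivative ((R' s, (1 / \<rho> s) *\<^sub>R R'' s + (- (R s \<bullet> R' s) / \<rho> s ^ 3) *\<^sub>R R' s),
        \<rho> s * (- \<beta> * norm (\<tau> s)))) (at s within {a..b})"
      unfolding Z_def[abs_def] using dM[OF s]
      by (intro has_vector_derivative_Pair R[OF s]) (auto simp: has_real_derivative_iff_has_vector_derivative)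
    moreover have "(1 / \<rho> s) *\<^sub>R R'' s + (- (R s \<bullet> R' s) / \<rho> s ^ 3) *\<^sub>R R' s
        = \<rho> s *\<^sub>R (- (\<mu> / \<rho> s ^ 3) *\<^sub>R R s + (1 / M s) *\<^sub>R \<tau> s)"
    proof -
      have "\<rho> s * (1 / (\<rho> s)\<^sup>2) = 1 / \<rho> s" "\<rho> s * (R s \<bullet> R' s / \<rho> s ^ 4) = (R s \<bullet> R' s) / \<rho> s ^ 3"
        using \<rho> by (simp_all add: field_simps eval_nat_numeral)
      moreover have "- (\<mu> / \<rho> s ^ 3) *\<^sub>R R s + (1 / M s) *\<^sub>R \<tau> s
          = (1 / (\<rho> s)\<^sup>2) *\<^sub>R R'' s - (R s \<bullet> R' s / \<rho> s ^ 4) *\<^sub>R R' s"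
        using Mpos[of s] by (simp add: \<tau>_def u_def required_acc_def \<rho>_def)
      ultimately show ?thesis by (simp add: scaleR_diff_right)
    qed
    moreover have "\<rho> s *\<^sub>R (1 / \<rho> s) *\<^sub>R R' s = R' s" using \<rho> by simp
    ultimately show ?thesis
      by (simp add: f_def sat_field_def Z_def \<rho>_def)
  qed
  have cf: "continuous_on {a..b} f"
  proof -
    have "f = (\<lambda>s. (((1 / \<rho> s) *\<^sub>R R' s, - (\<mu> / \<rho> s ^ 3) *\<^sub>R R s + (1 / M s) *\<^sub>R \<tau> s), - \<beta> * norm (\<tau> s)))"
      by (auto simp: f_def sat_field_def Z_def \<rho>_def fun_eq_iff)
    moreover have "M s \<noteq> 0" for s using Mpos[of s] by simp
    moreover have "\<rho> s \<noteq> 0" if "s \<in> {a..b}" for s using R0[OF that] by (simp add: \<rho>_def)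
    ultimately show ?thesis unfolding \<tau>_def
      by (auto intro!: continuous_intros c\<rho> cu cM cR)
  qed
  have \<rho>pos: "\<rho> s > 0" if "s \<in> {a..b}" for s using R0[OF that] by (simp add: \<rho>_def)
  obtain T \<theta> C where \<theta>: "T \<ge> 0" "continuous_on {0..T} \<theta>" "\<theta> ` {0..T} \<subseteq> {a..b}"
    "\<theta> 0 = a" "\<theta> T = b" "C-lipschitz_on {0..T} (Z \<circ> \<theta>)"
    "\<And>t. t \<in> {0<..<T} \<Longrightarrow> ((Z \<circ> \<theta>) has_vector_derivative f (\<theta> t)) (at t)"
    using time_change[OF ab dZ c\<rho> cf \<rho>pos] by blast
  \<comment> \<open>Outside the time interval the control is set to zero, which makes it Borel measurable.\<close>
  define \<tau>' where "\<tau>' t = indicator {0..T} t *\<^sub>R \<tau> (\<theta> t)" for t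
  have "continuous_on {a..b} \<tau>" unfolding \<tau>_def by (intro continuous_intros cM cu)
  then have "continuous_on {0..T} (\<lambda>t. \<tau> (\<theta> t))"
    by (rule continuous_on_compose2[OF _ \<theta>(2,3)])
  then have "\<tau>' \<in> borel_measurable borel"
    unfolding \<tau>'_def by (intro borel_measurable_continuous_on_indicator) auto
  moreover have "0 \<le> \<tau>max" using \<tau>le[of a] norm_ge_zero[of "\<tau> a"] ab by (simp del: norm_ge_zero)
  then have "norm (\<tau>' t) \<le> \<tau>max" for t
    using \<tau>le[of "\<theta> t"] \<theta>(3)
    by (cases "t \<in> {0..T}") (auto simp: \<tau>'_def image_subset_iff)
  moreover have "((Z \<circ> \<theta>) has_vector_derivative sat_field \<mu> \<beta> (\<tau>' t) ((Z \<circ> \<theta>) t)) (at t)"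
    if "t \<in> {0<..<T} - {}" for t
    using \<theta>(7)[of t] that by (simp add: \<tau>'_def f_def)
  moreover have "fst ((Z \<circ> \<theta>) t) \<in> admissible_region \<mu> r\<^sub>c \<and> snd ((Z \<circ> \<theta>) t) > 0" if "t \<in> {0..T}" for t
    using adm[of "\<theta> t"] Mpos[of "\<theta> t"] \<theta>(3) that
    by (auto simp: Z_def \<rho>_def image_subset_iff)
  moreover have "(Z \<circ> \<theta>) 0 = ((R a, (1 / norm (R a)) *\<^sub>R R' a), m)"
    by (simp add: Z_def M_def J_def \<rho>_def \<theta>)
  moreover have "(Z \<circ> \<theta>) T = ((R b, (1 / norm (R b)) *\<^sub>R R' b), M b)"
    by (simp add: Z_def \<rho>_def \<theta>)
  ultimately have "transfer \<mu> \<beta> r\<^sub>c \<tau>max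
     ((R a, (1 / norm (R a)) *\<^sub>R R' a), m) ((R b, (1 / norm (R b)) *\<^sub>R R' b), M b)"
    unfolding transfer_def using \<theta>(1,6)
    by (intro exI[of _ T] conjI exI[of _ \<tau>'] exI[of _ "Z \<circ> \<theta>"] exI[of _ "{}"] exI[of _ C]) auto
  then show ?thesis using Mpos Mle by blast
qed

lemma lipschitz_imp_abs_continuous_on:
  fixes f :: "real \<Rightarrow> 'a::metric_space"
  assumes "C-lipschitz_on {a..b} f"
  shows "abs_continuous_on a b f"
  unfolding abs_continuous_on_def
proof (intro allI impI)
  fix \<epsilon> :: real assume \<epsilon>: "\<epsilon> > 0"
  have C: "C \<ge> 0" using assms by (rule lipschitz_on_nonneg)
  have *: "(\<Sum>(s, t)\<in>D. dist (f s) (f t)) < \<epsilon>"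
    if D: "finite D" "\<forall>(s, t)\<in>D. a \<le> s \<and> s < t \<and> t \<le> b" "(\<Sum>(s, t)\<in>D. t - s) < \<epsilon> / (C + 1)" for D
  proof -
    have "(\<Sum>(s, t)\<in>D. dist (f s) (f t)) \<le> (\<Sum>(s, t)\<in>D. C * (t - s))"
    proof (intro sum_mono, clarify)
      fix s t assume "(s, t) \<in> D"
      then have "a \<le> s" "s < t" "t \<le> b" using D(2) by auto
      then show "dist (f s) (f t) \<le> C * (t - s)"
        using lipschitz_onD[OF assms, of s t] by (simp add: dist_real_def)
    qed
    also have "\<dots> = C * (\<Sum>(s, t)\<in>D. t - s)"
      by (simp add: sum_distrib_left case_prod_beta)
    also have "\<dots> \<le> C * (\<epsilon> / (C + 1))"
      using D(3) C by (intro mult_left_mono) auto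
    also have "\<dots> < \<epsilon>" using \<epsilon> C by (simp add: field_simps)
    finally show ?thesis .
  qed
  show "\<exists>\<delta>>0. \<forall>D. finite D \<and> (\<forall>(s, t)\<in>D. a \<le> s \<and> s < t \<and> t \<le> b) \<and>
        disjoint_family_on (\<lambda>(s, t). {s<..<t}) D \<and> (\<Sum>(s, t)\<in>D. t - s) < \<delta> \<longrightarrow>
        (\<Sum>(s, t)\<in>D. dist (f s) (f t)) < \<epsilon>"
    by (rule exI[of _ "\<epsilon> / (C + 1)"]) (use * \<epsilon> C in auto)
qed

text \<open>The mass is continuous and positive on a compact interval, so its minimum serves as the lower
  bound; the finite exceptional set and the two end points form a null set.\<close>

lemma transfer_imp_trajectory:
  assumes "transfer \<mu> \<beta> r\<^sub>c \<tau>max (x\<^sub>i, m\<^sub>i) (x\<^sub>f, m\<^sub>f)"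
  shows "\<exists>t\<^sub>f\<ge>0. \<exists>M\<^sub>0>0. \<exists>\<tau>. admissible_control \<tau>max t\<^sub>f \<tau> \<and>
          (\<exists>x m. trajectory_on \<mu> \<beta> \<tau> (x\<^sub>i, m\<^sub>i) t\<^sub>f x m \<and>
             (\<forall>t\<in>{0..t\<^sub>f}. x t \<in> admissible_region \<mu> r\<^sub>c \<and> m t \<ge> M\<^sub>0) \<and>
             x t\<^sub>f = x\<^sub>f)"
proof -
  obtain T \<tau> Z N C where T: "T \<ge> 0" "\<tau> \<in> borel_measurable borel" "\<forall>t. norm (\<tau> t) \<le> \<tau>max"
    "Z 0 = (x\<^sub>i, m\<^sub>i)" "Z T = (x\<^sub>f, m\<^sub>f)" "C-lipschitz_on {0..T} Z"
    "\<forall>t\<in>{0..T}. fst (Z t) \<in> admissible_region \<mu> r\<^sub>c \<and> snd (Z t) > 0" "finite N"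
    "\<forall>t\<in>{0<..<T} - N. (Z has_vector_derivative sat_field \<mu> \<beta> (\<tau> t) (Z t)) (at t)"
    using assms unfolding transfer_def by blast
  define x m where "x = (\<lambda>t. fst (Z t))" and "m = (\<lambda>t. snd (Z t))"
  have Z: "(\<lambda>t. (x t, m t)) = Z" by (simp add: x_def m_def)
  have "continuous_on {0..T} m"
    unfolding m_def by (intro continuous_intros lipschitz_on_continuous_on[OF T(6)])
  then obtain t0 where t0: "t0 \<in> {0..T}" "\<And>t. t \<in> {0..T} \<Longrightarrow> m t0 \<le> m t"
    using continuous_attains_inf[of "{0..T}" m] T(1) by fastforce
  have "admissible_control \<tau>max T \<tau>"
    unfolding admissible_control_def thrust_set_def
    using T(2,3) by (auto intro!: measurable_restrict_space1 measurable_completion)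
  moreover have "trajectory_on \<mu> \<beta> \<tau> (x\<^sub>i, m\<^sub>i) T x m"
    unfolding trajectory_on_def Z
  proof (intro conjI ballI)
    show "(x 0, m 0) = (x\<^sub>i, m\<^sub>i)" using T by (simp add: x_def m_def)
    show "(x t, m t) \<in> state_space" if "t \<in> {0..T}" for t
      using T(7) that by (auto simp: x_def m_def state_space_def admissible_region_def
          periodic_region_def case_prod_beta)
    show "abs_continuous_on 0 T Z" by (rule lipschitz_imp_abs_continuous_on[OF T(6)])
    have "negligible (N \<union> {0, T})" using T(8) by (simp add: negligible_finite)
    then have null: "AE t in lebesgue. t \<notin> N \<union> {0, T}"
      using AE_not_in negligible_iff_null_sets by blast
    have "AE t in lebesgue. t \<in> {0..T} \<longrightarrow>
        (Z has_vector_derivative sat_field \<mu> \<beta> (\<tau> t) (x t, m t)) (at t within {0..T})"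
    proof (rule AE_mp[OF null], intro AE_I2 impI)
      fix t assume "t \<notin> N \<union> {0, T}" "t \<in> {0..T}"
      then have "t \<in> {0<..<T} - N" by auto
      then show "(Z has_vector_derivative sat_field \<mu> \<beta> (\<tau> t) (x t, m t)) (at t within {0..T})"
        using T(9) by (auto simp: x_def m_def intro: has_vector_derivative_at_within)
    qed
    then show "AE t in lebesgue_on {0..T}. (Z has_vector_derivative
        sat_field \<mu> \<beta> (\<tau> t) (x t, m t)) (at t within {0..T})"
      by (simp add: AE_restrict_space_iff)
  qed
  moreover have "\<forall>t\<in>{0..T}. x t \<in> admissible_region \<mu> r\<^sub>c \<and> m t \<ge> m t0"
    using T(7) t0 by (auto simp: x_def)
  moreover have "x T = x\<^sub>f" using T by (simp add: x_def)
  moreover have "m t0 > 0" using T(7) t0 by (simp add: m_def)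
  ultimately show ?thesis
    using T(1) by (intro exI[of _ T] exI[of _ "m t0"] exI[of _ \<tau>] conjI exI[of _ x] exI[of _ m])
qed

section \<open>Steering between neighbouring orbits\<close>

lemma required_acc_coast:
  assumes mu: "\<mu> > 0" and x: "x \<in> periodic_region \<mu>"
  shows "required_acc \<mu> (coast_pos \<mu> x s) (coast_pos' \<mu> x s) (coast_pos'' \<mu> x s) = 0"
proof -
  let ?d = "coast_dist \<mu> x s"
  have d: "?d > 0" by (rule coast_dist_pos[OF mu x])
  have c: "?d ^ 3 * (1 / ?d\<^sup>2) = ?d" "?d ^ 3 * (?d * coast_dist' \<mu> x s / ?d ^ 4) = coast_dist' \<mu> x s"
     "?d ^ 3 * (\<mu> / ?d ^ 3) = \<mu>"
    using d by (simp_all add: field_simps eval_nat_numeral)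
  have "?d ^ 3 *\<^sub>R required_acc \<mu> (coast_pos \<mu> x s) (coast_pos' \<mu> x s) (coast_pos'' \<mu> x s)
      = (\<mu> *\<^sub>R coast_pos \<mu> x s + ?d *\<^sub>R coast_pos'' \<mu> x s) - coast_dist' \<mu> x s *\<^sub>R coast_pos' \<mu> x s"
    unfolding required_acc_def norm_coast_pos[OF mu x] inner_coast_pos'[OF mu x]
      scaleR_add_right scaleR_diff_right scaleR_scaleR c by simp
  also have "\<dots> = 0" by (simp add: coast_pos_ode[OF mu x])
  finally show ?thesis using d by simp
qed

text \<open>The final mass again lies below the threshold \<open>m\<^sub>0\<close>, so a second transfer can start from it; this
  makes the relation transitive. A mass below the threshold can be
  given every acceleration up to \<open>\<tau>max / m\<^sub>0\<close>.\<close>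

definition reach :: "real \<Rightarrow> real \<Rightarrow> real \<Rightarrow> real \<Rightarrow> real \<Rightarrow> orbit_state \<Rightarrow> orbit_state \<Rightarrow> bool" where
  "reach \<mu> \<beta> r\<^sub>c \<tau>max m\<^sub>0 x y \<longleftrightarrow>
     (\<forall>m. 0 < m \<and> m \<le> m\<^sub>0 \<longrightarrow> (\<exists>m'. 0 < m' \<and> m' \<le> m \<and> transfer \<mu> \<beta> r\<^sub>c \<tau>max (x, m) (y, m')))"

lemma reach_trans:
  assumes "reach \<mu> \<beta> r\<^sub>c \<tau>max m\<^sub>0 x y" "reach \<mu> \<beta> r\<^sub>c \<tau>max m\<^sub>0 y z"
  shows "reach \<mu> \<beta> r\<^sub>c \<tau>max m\<^sub>0 x z"
  unfolding reach_def
proof (intro allI impI)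
  fix m assume m: "0 < m \<and> m \<le> m\<^sub>0"
  then obtain m' where m': "0 < m'" "m' \<le> m" "transfer \<mu> \<beta> r\<^sub>c \<tau>max (x, m) (y, m')"
    using assms(1) unfolding reach_def by blast
  then obtain m'' where "0 < m''" "m'' \<le> m'" "transfer \<mu> \<beta> r\<^sub>c \<tau>max (y, m') (z, m'')"
    using assms(2) m unfolding reach_def by (meson order_trans)
  then show "\<exists>m'. 0 < m' \<and> m' \<le> m \<and> transfer \<mu> \<beta> r\<^sub>c \<tau>max (x, m) (z, m')"
    using m' transfer_trans by (meson order_trans)
qed

text \<open>The closed orbit lets \<open>b\<close> be replaced by \<open>b\<close> plus a multiple of the period, so a point that lies
  behind on the orbit is reached as well.\<close>

lemma reach_along_coast:
  assumes mu: "\<mu> > 0" and "\<beta> \<ge> 0" "\<tau>max \<ge> 0" and x: "x \<in> stable_periodic_region \<mu> r\<^sub>c"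
  shows "reach \<mu> \<beta> r\<^sub>c \<tau>max m\<^sub>0 (coast \<mu> x a) (coast \<mu> x b)"
proof -
  have per: "x \<in> periodic_region \<mu>" using x by (simp add: stable_periodic_region_def)
  let ?P = "2 * pi / freq \<mu> x"
  have P: "?P > 0" using freq_pos[OF per] by simp
  obtain n :: nat where n: "a - b < real n * ?P"
    using reals_Archimedean3[OF P] by blast
  define b' where "b' = b + real n * ?P"
  have ab: "a \<le> b'" using n by (simp add: b'_def)
  have adm: "(coast_pos \<mu> x s, (1 / norm (coast_pos \<mu> x s)) *\<^sub>R coast_pos' \<mu> x s) \<in> admissible_region \<mu> r\<^sub>c" for s
    using coast_in_stable[OF mu x, of s] stable_subset_admissible[OF mu] by (auto simp: coast_def)
  have cont: "continuous_on {a..b'} (coast_pos'' \<mu> x)"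
    unfolding coast_pos''_def Let_def by (intro continuous_intros)
  have "reach \<mu> \<beta> r\<^sub>c \<tau>max m\<^sub>0 (coast \<mu> x a) (coast \<mu> x b')"
    unfolding reach_def coast_def
  proof (intro allI impI)
    fix m assume "0 < m \<and> m \<le> m\<^sub>0"
    then show "\<exists>m'>0. m' \<le> m \<and> transfer \<mu> \<beta> r\<^sub>c \<tau>max
      ((coast_pos \<mu> x a, (1 / norm (coast_pos \<mu> x a)) *\<^sub>R coast_pos' \<mu> x a), m)
      ((coast_pos \<mu> x b', (1 / norm (coast_pos \<mu> x b')) *\<^sub>R coast_pos' \<mu> x b'), m')"
      by (intro curve_transfer[where R'' = "coast_pos'' \<mu> x"] has_derivative_coast_pos
           has_derivative_coast_pos' per adm cont ab \<open>\<beta> \<ge> 0\<close>)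
         (auto simp: required_acc_coast[OF mu per] \<open>\<tau>max \<ge> 0\<close>)
  qed
  then show ?thesis unfolding b'_def coast_periodic[OF per] .
qed

lemma open_admissible_region: "open (admissible_region \<mu> r\<^sub>c)"
proof -
  let ?S = "{x :: orbit_state. fst x \<noteq> 0}"
  have S: "open ?S"
    by (intro open_Collect_neq continuous_intros)
  have "continuous_on ?S (\<lambda>x. (ang_mom x, energy \<mu> x, norm (fst x)))"
    unfolding ang_mom_def energy_def case_prod_beta
    by (intro continuous_intros continuous_on_cross) auto
  then have "open (?S \<inter> (\<lambda>x. (ang_mom x, energy \<mu> x, norm (fst x))) -` ((- {0}) \<times> {..<0} \<times> {r\<^sub>c<..}))"
    by (rule continuous_open_preimage[OF _ S]) (intro open_Times open_Compl; simp)
  moreover have "?S \<inter> (\<lambda>x. (ang_mom x, energy \<mu> x, norm (fst x))) -` ((- {0}) \<times> {..<0} \<times> {r\<^sub>c<..})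
      = admissible_region \<mu> r\<^sub>c"
    by (auto simp: admissible_region_def periodic_region_def)
  ultimately show ?thesis by simp
qed

text \<open>The case of a negative lower bound on the distance.\<close>

lemma open_periodic_region: "open (periodic_region \<mu>)"
proof -
  have "periodic_region \<mu> = admissible_region \<mu> (-1)"
    using less_le_trans[OF _ norm_ge_zero, of "-1"] by (auto simp: admissible_region_def)
  then show ?thesis by (simp add: open_admissible_region)
qed

lemma continuous_on_coast:
  fixes f :: "'a::t2_space \<Rightarrow> orbit_state"
  assumes f: "continuous_on S f" and g: "continuous_on S g"
    and per: "\<And>t. t \<in> S \<Longrightarrow> f t \<in> periodic_region \<mu>"
  shows "continuous_on S (\<lambda>t. coast_pos \<mu> (f t) (g t))"
    and "continuous_on S (\<lambda>t. coast_pos' \<mu> (f t) (g t))"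
    and "continuous_on S (\<lambda>t. coast_pos'' \<mu> (f t) (g t))"
proof -
  have nz: "fst (f t) \<noteq> 0" if "t \<in> S" for t using per[OF that] by (simp add: periodic_region_def)
  have w: "continuous_on S (\<lambda>t. freq \<mu> (f t))"
    unfolding freq_def energy_def case_prod_beta by (intro continuous_intros f) (use nz in auto)
  have nw: "freq \<mu> (f t) \<noteq> 0" if "t \<in> S" for t using freq_pos[OF per[OF that]] by simp
  show "continuous_on S (\<lambda>t. coast_pos \<mu> (f t) (g t))"
    unfolding coast_pos_def Let_def
    by (intro continuous_intros f g w) (use nz nw in auto)
  show "continuous_on S (\<lambda>t. coast_pos' \<mu> (f t) (g t))"
    unfolding coast_pos'_def Let_def
    by (intro continuous_intros f g w) (use nz nw in auto)
  show "continuous_on S (\<lambda>t. coast_pos'' \<mu> (f t) (g t))"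
    unfolding coast_pos''_def Let_def
    by (intro continuous_intros f g w) (use nz nw in auto)
qed

text \<open>Passage from the free motion of \<open>y\<close> at \<open>s = 0\<close> to that of \<open>z\<close> at \<open>s = 1\<close>. The weight
  \<open>3 s\<^sup>2 - 2 s\<^sup>3\<close> has vanishing derivative at both ends, so that the velocities agree there as well.\<close>

definition blend_pos :: "real \<Rightarrow> orbit_state \<Rightarrow> orbit_state \<Rightarrow> real \<Rightarrow> real ^ 3" where
  "blend_pos \<mu> y z s = coast_pos \<mu> y s
     + (3 * s\<^sup>2 - 2 * s ^ 3) *\<^sub>R (coast_pos \<mu> z s - coast_pos \<mu> y s)"

definition blend_pos' :: "real \<Rightarrow> orbit_state \<Rightarrow> orbit_state \<Rightarrow> real \<Rightarrow> real ^ 3" where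
  "blend_pos' \<mu> y z s = coast_pos' \<mu> y s
     + ((3 * s\<^sup>2 - 2 * s ^ 3) *\<^sub>R (coast_pos' \<mu> z s - coast_pos' \<mu> y s)
     + (6 * s - 6 * s\<^sup>2) *\<^sub>R (coast_pos \<mu> z s - coast_pos \<mu> y s))"

definition blend_pos'' :: "real \<Rightarrow> orbit_state \<Rightarrow> orbit_state \<Rightarrow> real \<Rightarrow> real ^ 3" where
  "blend_pos'' \<mu> y z s = coast_pos'' \<mu> y s
     + (((3 * s\<^sup>2 - 2 * s ^ 3) *\<^sub>R (coast_pos'' \<mu> z s - coast_pos'' \<mu> y s)
       + (6 * s - 6 * s\<^sup>2) *\<^sub>R (coast_pos' \<mu> z s - coast_pos' \<mu> y s))
     + ((6 * s - 6 * s\<^sup>2) *\<^sub>R (coast_pos' \<mu> z s - coast_pos' \<mu> y s)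
       + (6 - 12 * s) *\<^sub>R (coast_pos \<mu> z s - coast_pos \<mu> y s)))"

lemma has_derivative_blend_pos:
  assumes "y \<in> periodic_region \<mu>" "z \<in> periodic_region \<mu>"
  shows "(blend_pos \<mu> y z has_vector_derivative blend_pos' \<mu> y z s) (at s within A)"
  unfolding blend_pos_def[abs_def] blend_pos'_def
  by (intro has_vector_derivative_add has_vector_derivative_scaleR has_vector_derivative_diff
      has_derivative_coast_pos assms)
    (auto intro!: derivative_eq_intros)

lemma has_derivative_blend_pos':
  assumes "y \<in> periodic_region \<mu>" "z \<in> periodic_region \<mu>"
  shows "(blend_pos' \<mu> y z has_vector_derivative blend_pos'' \<mu> y z s) (at s within A)"
  unfolding blend_pos'_def[abs_def] blend_pos''_def
  by (intro has_vector_derivative_add has_vector_derivative_scaleR has_vector_derivative_diff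
      has_derivative_coast_pos has_derivative_coast_pos' assms)
    (auto intro!: derivative_eq_intros)

text \<open>The triples \<open>(R, R', R'')\<close> that may occur along a curve whose states are admissible and whose required
  acceleration stays below \<open>\<epsilon>\<close>.\<close>

definition gentle_jets :: "real \<Rightarrow> real \<Rightarrow> real \<Rightarrow> ((real ^ 3) \<times> (real ^ 3) \<times> (real ^ 3)) set" where
  "gentle_jets \<mu> r\<^sub>c \<epsilon> = {(R, R', R''). R \<noteq> 0 \<and> norm (required_acc \<mu> R R' R'') < \<epsilon> \<and>
     (R, (1 / norm R) *\<^sub>R R') \<in> admissible_region \<mu> r\<^sub>c}"

lemma open_gentle_jets: "open (gentle_jets \<mu> r\<^sub>c \<epsilon>)"
proof -
  let ?S = "{j :: (real ^ 3) \<times> (real ^ 3) \<times> (real ^ 3). fst j \<noteq> 0}"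
  let ?f = "\<lambda>j :: (real ^ 3) \<times> (real ^ 3) \<times> (real ^ 3).
     (norm (required_acc \<mu> (fst j) (fst (snd j)) (snd (snd j))), fst j, (1 / norm (fst j)) *\<^sub>R fst (snd j))"
  have S: "open ?S" by (intro open_Collect_neq continuous_intros)
  have "continuous_on ?S ?f"
    unfolding required_acc_def by (intro continuous_intros) auto
  then have "open (?S \<inter> ?f -` ({..<\<epsilon>} \<times> admissible_region \<mu> r\<^sub>c))"
    by (rule continuous_open_preimage[OF _ S]) (intro open_Times open_admissible_region open_lessThan)
  moreover have "?S \<inter> ?f -` ({..<\<epsilon>} \<times> admissible_region \<mu> r\<^sub>c) = gentle_jets \<mu> r\<^sub>c \<epsilon>"
    by (auto simp: gentle_jets_def)
  ultimately show ?thesis by simp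
qed

text \<open>For \<open>y = z = x\<close> the blend is the free motion, whose required acceleration vanishes and whose jets are
  therefore gentle. Gentleness is an open condition and the parameter interval is compact, so by
  the tube lemma all blends between \<open>y\<close> and \<open>z\<close> near \<open>x\<close> are gentle. The blend leads to the
  state reached from \<open>z\<close> after one unit of fictitious time, and coasting closes the gap.\<close>

lemma reach_locally:
  assumes mu: "\<mu> > 0" and \<beta>: "\<beta> \<ge> 0" and \<tau>: "\<tau>max > 0" and m0: "m\<^sub>0 > 0"
    and x: "x \<in> stable_periodic_region \<mu> r\<^sub>c"
  obtains U where "open U" "x \<in> U"
    "\<And>y z. y \<in> U \<Longrightarrow> z \<in> U \<inter> stable_periodic_region \<mu> r\<^sub>c \<Longrightarrow> reach \<mu> \<beta> r\<^sub>c \<tau>max m\<^sub>0 y z"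
proof -
  let ?G = "gentle_jets \<mu> r\<^sub>c (\<tau>max / m\<^sub>0)"
  let ?D = "(periodic_region \<mu> \<times> periodic_region \<mu>) \<times> (UNIV :: real set)"
  define jet where "jet p = (let y = fst (fst p); z = snd (fst p); s = snd p in
      (blend_pos \<mu> y z s, blend_pos' \<mu> y z s, blend_pos'' \<mu> y z s))" for p
  have per: "x \<in> periodic_region \<mu>" using x by (simp add: stable_periodic_region_def)
  have D: "open ?D" by (intro open_Times open_periodic_region open_UNIV)
  have "continuous_on ?D jet"
    unfolding jet_def Let_def blend_pos_def blend_pos'_def blend_pos''_def
    by (intro continuous_intros continuous_on_coast) auto
  then have W: "open (?D \<inter> jet -` ?G)"
    by (rule continuous_open_preimage[OF _ D open_gentle_jets])
  have "{(x, x)} \<times> {0..1} \<subseteq> ?D \<inter> jet -` ?G"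
  proof
    fix p assume "p \<in> {(x, x)} \<times> {0..1::real}"
    then obtain s where p: "p = ((x, x), s)" by auto
    have "jet p = (coast_pos \<mu> x s, coast_pos' \<mu> x s, coast_pos'' \<mu> x s)"
      by (simp add: p jet_def blend_pos_def blend_pos'_def blend_pos''_def)
    moreover have "coast \<mu> x s \<in> admissible_region \<mu> r\<^sub>c"
      using coast_in_stable[OF mu x] stable_subset_admissible[OF mu] by blast
    moreover have "coast_pos \<mu> x s \<noteq> 0"
      using fst_coast_nonzero[OF mu per] by (simp add: coast_def)
    ultimately show "p \<in> ?D \<inter> jet -` ?G"
      using per \<tau> m0 by (simp add: gentle_jets_def required_acc_coast[OF mu per] p coast_def)
  qed
  from Elementary_Topology.tube_lemma[OF compact_Icc W this]
  obtain X where X: "open X" "(x, x) \<in> X" "X \<times> {0..1} \<subseteq> ?D \<inter> jet -` ?G"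
    by (elim exE conjE)
  obtain A B where "open A" "open B" "(x, x) \<in> A \<times> B" "A \<times> B \<subseteq> X"
    using open_prod_elim[OF X(1,2)] .
  then have AB: "open A" "open B" "x \<in> A" "x \<in> B" "A \<times> B \<subseteq> X" by auto
  have "reach \<mu> \<beta> r\<^sub>c \<tau>max m\<^sub>0 y z" if y: "y \<in> A \<inter> B" and z: "z \<in> A \<inter> B \<inter> stable_periodic_region \<mu> r\<^sub>c" for y z
  proof -
    have in_W: "((y, z), s) \<in> ?D \<inter> jet -` ?G" if "s \<in> {0..1}" for s
    proof (rule subsetD[OF X(3)])
      show "((y, z), s) \<in> X \<times> {0..1}" using AB(5) y z that by auto
    qed
    then have pyz: "y \<in> periodic_region \<mu>" "z \<in> periodic_region \<mu>"
      using in_W[of 0] by auto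
    have J: "norm (required_acc \<mu> (blend_pos \<mu> y z s) (blend_pos' \<mu> y z s) (blend_pos'' \<mu> y z s)) < \<tau>max / m\<^sub>0"
      "(blend_pos \<mu> y z s, (1 / norm (blend_pos \<mu> y z s)) *\<^sub>R blend_pos' \<mu> y z s) \<in> admissible_region \<mu> r\<^sub>c"
      if "s \<in> {0..1}" for s
      using in_W[OF that] by (auto simp: jet_def gentle_jets_def)
    have acc: "m * norm (required_acc \<mu> (blend_pos \<mu> y z s) (blend_pos' \<mu> y z s) (blend_pos'' \<mu> y z s)) \<le> \<tau>max"
      if "s \<in> {0..1}" "0 < m" "m \<le> m\<^sub>0" for s m
    proof -
      have "m * norm (required_acc \<mu> (blend_pos \<mu> y z s) (blend_pos' \<mu> y z s) (blend_pos'' \<mu> y z s))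
          \<le> m\<^sub>0 * (\<tau>max / m\<^sub>0)"
        using J(1)[OF that(1)] that by (intro mult_mono) auto
      then show ?thesis using m0 by simp
    qed
    have cont: "continuous_on {0..1} (blend_pos'' \<mu> y z)"
      unfolding blend_pos''_def by (intro continuous_intros continuous_on_coast pyz)
    have ends: "(blend_pos \<mu> y z 0, (1 / norm (blend_pos \<mu> y z 0)) *\<^sub>R blend_pos' \<mu> y z 0) = coast \<mu> y 0"
      "(blend_pos \<mu> y z 1, (1 / norm (blend_pos \<mu> y z 1)) *\<^sub>R blend_pos' \<mu> y z 1) = coast \<mu> z 1"
      by (simp_all add: blend_pos_def blend_pos'_def coast_def)
    have nz: "fst y \<noteq> 0" "fst z \<noteq> 0" using pyz by (auto simp: periodic_region_def)
    have "reach \<mu> \<beta> r\<^sub>c \<tau>max m\<^sub>0 (coast \<mu> y 0) (coast \<mu> z 1)"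
      unfolding reach_def ends[symmetric]
    proof (intro allI impI)
      fix m assume m: "0 < m \<and> m \<le> m\<^sub>0"
      show "\<exists>m'>0. m' \<le> m \<and> transfer \<mu> \<beta> r\<^sub>c \<tau>max
        ((blend_pos \<mu> y z 0, (1 / norm (blend_pos \<mu> y z 0)) *\<^sub>R blend_pos' \<mu> y z 0), m)
        ((blend_pos \<mu> y z 1, (1 / norm (blend_pos \<mu> y z 1)) *\<^sub>R blend_pos' \<mu> y z 1), m')"
        by (rule curve_transfer[where R'' = "blend_pos'' \<mu> y z"])
          (use \<beta> m J acc cont has_derivative_blend_pos[OF pyz] has_derivative_blend_pos'[OF pyz] in auto)
    qed
    moreover have "reach \<mu> \<beta> r\<^sub>c \<tau>max m\<^sub>0 (coast \<mu> z 1) (coast \<mu> z 0)"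
      using reach_along_coast[OF mu \<beta>] \<tau> z by simp
    ultimately show ?thesis
      using reach_trans[of \<mu> \<beta> r\<^sub>c \<tau>max m\<^sub>0 "coast \<mu> y 0"]
      unfolding coast_0[OF nz(1)] coast_0[OF nz(2)] by blast
  qed
  with AB show ?thesis by (intro that[of "A \<inter> B"]) auto
qed

section \<open>The connected set of perigee states\<close>

text \<open>States with orthogonal position and velocity whose speed lies between that of the circular orbit
  (included) and the escape speed (excluded): these are the perigees of elliptic orbits, or points of circular ones.\<close>

definition apses :: "real \<Rightarrow> real \<Rightarrow> orbit_state set" where
  "apses \<mu> r\<^sub>c = {(r, v). r \<bullet> v = 0 \<and> norm r > r\<^sub>c \<and>
     \<mu> / norm r \<le> (norm v)\<^sup>2 \<and> (norm v)\<^sup>2 < 2 * (\<mu> / norm r)}"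

lemma apses_subset_stable:
  assumes mu: "\<mu> > 0" and "r\<^sub>c \<ge> 0"
  shows "apses \<mu> r\<^sub>c \<subseteq> stable_periodic_region \<mu> r\<^sub>c"
proof
  fix x assume x: "x \<in> apses \<mu> r\<^sub>c"
  obtain r v where rv: "x = (r, v)" by (cases x)
  define d V where "d = norm r" and "V = (norm v)\<^sup>2"
  have a: "r \<bullet> v = 0" "d > r\<^sub>c" "\<mu> / d \<le> V" "V < 2 * (\<mu> / d)"
    using x by (auto simp: apses_def rv d_def V_def)
  have d: "d > 0" using a \<open>r\<^sub>c \<ge> 0\<close> by simp
  then have V: "V > 0" using a(3) mu by (smt (verit) divide_pos_pos)
  have h: "(norm (ang_mom x))\<^sup>2 = d\<^sup>2 * V"
    by (simp add: rv norm_ang_mom a d_def V_def)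
  have "norm (laplace_vec \<mu> x) = (V - \<mu> / d) * d"
    using a(3) by (simp add: rv laplace_vec_eq a(1) flip: d_def V_def)
  moreover have "\<mu> * (1 + eccentricity \<mu> x) = \<mu> + norm (laplace_vec \<mu> x)"
    using mu by (simp add: eccentricity_def field_simps)
  moreover have "(V - \<mu> / d) * d = V * d - \<mu>"
    using d by (simp add: field_simps)
  ultimately have "\<mu> * (1 + eccentricity \<mu> x) = V * d" by simp
  then have "perigee \<mu> x = d"
    using V d unfolding perigee_def h by (simp add: power2_eq_square)
  moreover have "ang_mom x \<noteq> 0" using h d V by auto
  moreover have "energy \<mu> x = V / 2 - \<mu> / d" by (simp add: rv energy_def d_def V_def)
  then have "energy \<mu> x < 0" using a(4) by linarith
  moreover have "r \<noteq> 0" using d by (auto simp: d_def)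
  ultimately show "x \<in> stable_periodic_region \<mu> r\<^sub>c"
    using a(2) by (simp add: stable_periodic_region_def periodic_region_def rv)
qed

text \<open>The distance oscillates harmonically in \<open>s\<close>. At its minimum the derivative vanishes, so position and
  velocity are orthogonal, and the value is at most the mean \<open>\<mu> / w\<^sup>2\<close>, which by
  conservation of energy is the lower bound on the speed.\<close>

lemma coast_meets_apses:
  assumes mu: "\<mu> > 0" and x: "x \<in> stable_periodic_region \<mu> r\<^sub>c"
  obtains s where "coast \<mu> x s \<in> apses \<mu> r\<^sub>c"
proof -
  have per: "x \<in> periodic_region \<mu>" using x by (simp add: stable_periodic_region_def)
  define w where "w = freq \<mu> x"
  \<comment> \<open>The argument of this number is the phase at which the distance is minimal.\<close>
  define c where "c = Complex (\<mu> / w\<^sup>2 - norm (fst x)) (- (fst x \<bullet> snd x) / w)"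
  define \<phi> where "\<phi> = Arg c"
  have w: "w > 0" using freq_pos[OF per] by (simp add: w_def)
  have "c = rcis (cmod c) \<phi>" by (simp add: \<phi>_def rcis_cmod_Arg)
  then have c: "norm (fst x) - \<mu> / w\<^sup>2 = - (cmod c * cos \<phi>)" "(fst x \<bullet> snd x) / w = - (cmod c * sin \<phi>)"
    using Re_rcis[of "cmod c" \<phi>] Im_rcis[of "cmod c" \<phi>] by (auto simp: c_def)
  then have q: "fst x \<bullet> snd x = - (w * cmod c * sin \<phi>)" using w by (simp add: field_simps)
  define s where "s = \<phi> / w"
  have ws: "w * s = \<phi>" using w by (simp add: s_def)
  let ?d = "coast_dist \<mu> x s"
  have "?d = \<mu> / w\<^sup>2 - cmod c * ((cos \<phi>)\<^sup>2 + (sin \<phi>)\<^sup>2)"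
    unfolding coast_dist_def Let_def w_def[symmetric] ws c by algebra
  then have "?d \<le> \<mu> / w\<^sup>2" by simp
  then have le: "w\<^sup>2 * ?d \<le> \<mu>" using w by (simp add: field_simps)
  have "coast_dist' \<mu> x s = 0"
    unfolding coast_dist'_def Let_def w_def[symmetric] ws c q by simp
  then have orth: "coast_pos \<mu> x s \<bullet> coast_pos' \<mu> x s = 0"
    by (simp add: inner_coast_pos'[OF mu per])
  have d: "?d > 0" by (rule coast_dist_pos[OF mu per])
  have V: "(norm ((1 / ?d) *\<^sub>R coast_pos' \<mu> x s))\<^sup>2 = 2 * (\<mu> / ?d) - w\<^sup>2"
  proof -
    have "(norm ((1 / ?d) *\<^sub>R coast_pos' \<mu> x s))\<^sup>2 = (1 / ?d)\<^sup>2 * (norm (coast_pos' \<mu> x s))\<^sup>2"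
      by (simp add: power_divide)
    also have "\<dots> = 2 * (\<mu> / ?d) - w\<^sup>2"
      unfolding norm_coast_pos'[OF mu per] w_def[symmetric] using d
      by (simp add: field_simps power2_eq_square)
    finally show ?thesis .
  qed
  have "w\<^sup>2 \<le> \<mu> / ?d" using le d by (simp add: field_simps)
  moreover have "coast \<mu> x s \<in> admissible_region \<mu> r\<^sub>c"
    using coast_in_stable[OF mu x] stable_subset_admissible[OF mu] by blast
  then have "?d > r\<^sub>c"
    by (simp add: admissible_region_def coast_def norm_coast_pos[OF mu per])
  ultimately have "coast \<mu> x s \<in> apses \<mu> r\<^sub>c"
    unfolding apses_def coast_def norm_coast_pos[OF mu per] using orth V w
    by (simp add: norm_coast_pos[OF mu per])
  then show ?thesis by (rule that)
qed

definition orthonormal_frames :: "((real ^ 3) \<times> (real ^ 3)) set" where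
  "orthonormal_frames = {(a, b). norm a = 1 \<and> norm b = 1 \<and> a \<bullet> b = 0}"

lemma cross3_unit:
  assumes "norm a = 1" "norm b = 1" "a \<bullet> b = 0"
  shows "norm (cross3 a b) = 1" "a \<bullet> cross3 a b = 0" "b \<bullet> cross3 a b = 0"
proof -
  have "(norm (cross3 a b))\<^sup>2 = 1"
    using norm_cross_dot[of a b] assms by simp
  then show "norm (cross3 a b) = 1"
    using norm_ge_zero[of "cross3 a b"] by (simp add: power2_eq_1_iff)
  show "a \<bullet> cross3 a b = 0" "b \<bullet> cross3 a b = 0" by (simp_all add: dot_cross_self)
qed

text \<open>It is enough that the components of \<open>b'\<close> along \<open>b\<close> and \<open>a \<times> b\<close> have square sum 1. This holds because
  \<open>b \<times> b'\<close> is parallel to \<open>a\<close>, so that its length is the absolute value of the second component.\<close>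

lemma unit_orthogonal_eq_rotation:
  fixes a b b' :: "real ^ 3"
  assumes a: "norm a = 1" and b: "norm b = 1" "a \<bullet> b = 0" and b': "norm b' = 1" "a \<bullet> b' = 0"
  obtains t where "b' = cos t *\<^sub>R b + sin t *\<^sub>R cross3 a b"
proof -
  let ?c = "cross3 a b" and ?w = "cross3 b b'"
  note c = cross3_unit[OF a b]
  have "cross3 a ?w = 0"
    using Lagrange[of a b b'] b b' by simp
  then have "(a \<bullet> ?w)\<^sup>2 = (norm ?w)\<^sup>2"
    using norm_cross_dot[of a ?w] a by simp
  moreover have "(norm ?w)\<^sup>2 + (b \<bullet> b')\<^sup>2 = 1"
    using norm_cross_dot[of b b'] b b' by simp
  moreover have "b' \<bullet> ?c = a \<bullet> ?w"
    using cross_triple[of a b b'] by (simp add: inner_commute)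
  ultimately have "(b \<bullet> b')\<^sup>2 + (b' \<bullet> ?c)\<^sup>2 = 1" by simp
  then obtain t where t: "b \<bullet> b' = cos t" "b' \<bullet> ?c = sin t"
    using sincos_total_2pi by metis
  have inn: "b \<bullet> b = 1" "b' \<bullet> b' = 1" "?c \<bullet> ?c = 1" "b \<bullet> ?c = 0" "?c \<bullet> b = 0"
    "b' \<bullet> b = cos t" "?c \<bullet> b' = sin t"
    using b b' c t by (simp_all add: norm_eq_1 inner_commute)
  have "(norm (b' - (cos t *\<^sub>R b + sin t *\<^sub>R ?c)))\<^sup>2 = 1 - ((cos t)\<^sup>2 + (sin t)\<^sup>2)"
    unfolding power2_norm_eq_inner
    by (simp add: inner_add_left inner_add_right inner_diff_left inner_diff_right inn t power2_eq_square algebra_simps)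
  then have "b' = cos t *\<^sub>R b + sin t *\<^sub>R ?c" by simp
  then show ?thesis by (rule that)
qed

text \<open>Turning one vector of a frame while the other stays fixed gives a path. Three such turns connect
  \<open>(a, b)\<close> with \<open>(a', b')\<close> through \<open>(a, n)\<close> and \<open>(a', n)\<close>, where \<open>n\<close> is a common normal of \<open>a\<close> and \<open>a'\<close>.\<close>

lemma connected_orthonormal_frames: "connected orthonormal_frames"
proof -
  let ?F = orthonormal_frames
  have rot: "(a, cos t *\<^sub>R b + sin t *\<^sub>R cross3 a b) \<in> ?F"
    "(cos t *\<^sub>R b + sin t *\<^sub>R cross3 a b, a) \<in> ?F"
    if ab: "norm a = 1" "norm b = 1" "a \<bullet> b = 0" for a b :: "real ^ 3" and t
  proof -
    have "b \<bullet> b = 1" "cross3 a b \<bullet> cross3 a b = 1" using ab cross3_unit[OF ab] by (simp_all add: norm_eq_1)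
    then have "norm (cos t *\<^sub>R b + sin t *\<^sub>R cross3 a b) = 1"
      unfolding norm_eq_1 using cross3_unit[OF ab]
      by (simp add: inner_add_left inner_add_right inner_commute power2_eq_square[symmetric])
    moreover have "a \<bullet> (cos t *\<^sub>R b + sin t *\<^sub>R cross3 a b) = 0"
      using cross3_unit[OF ab] ab by (simp add: inner_add_right)
    ultimately show "(a, cos t *\<^sub>R b + sin t *\<^sub>R cross3 a b) \<in> ?F"
      "(cos t *\<^sub>R b + sin t *\<^sub>R cross3 a b, a) \<in> ?F"
      using ab by (simp_all add: orthonormal_frames_def inner_commute)
  qed
  have turn: "connected_component ?F (a, b) (a, b')" "connected_component ?F (b, a) (b', a)"
    if ab: "norm a = 1" "norm b = 1" "a \<bullet> b = 0" and b': "norm b' = 1" "a \<bullet> b' = 0" for a b b'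
  proof -
    obtain t where t: "b' = cos t *\<^sub>R b + sin t *\<^sub>R cross3 a b"
      using unit_orthogonal_eq_rotation[OF ab b'] .
    let ?p = "\<lambda>t. cos t *\<^sub>R b + sin t *\<^sub>R cross3 a b"
    have p: "?p 0 = b" "?p t = b'" using t by simp_all
    have con: "connected (range (\<lambda>t. (a, ?p t)))" "connected (range (\<lambda>t. (?p t, a)))"
      by (intro connected_continuous_image continuous_intros connected_UNIV)+
    have sub: "range (\<lambda>t. (a, ?p t)) \<subseteq> ?F" "range (\<lambda>t. (?p t, a)) \<subseteq> ?F"
      using rot[OF ab] by (auto simp only: image_subset_iff)
    show "connected_component ?F (a, b) (a, b')"
      by (rule connected_componentI[OF con(1) sub(1) range_eqI[of _ _ 0] range_eqI[of _ _ t]])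
         (simp_all only: p)
    show "connected_component ?F (b, a) (b', a)"
      by (rule connected_componentI[OF con(2) sub(2) range_eqI[of _ _ 0] range_eqI[of _ _ t]])
         (simp_all only: p)
  qed
  have "connected_component ?F (a, b) (a', b')" if F: "(a, b) \<in> ?F" "(a', b') \<in> ?F" for a b a' b'
  proof -
    have u: "norm a = 1" "norm b = 1" "a \<bullet> b = 0" "norm a' = 1" "norm b' = 1" "a' \<bullet> b' = 0"
      using F by (auto simp: orthonormal_frames_def)
    \<comment> \<open>If \<open>a\<close> and \<open>a'\<close> are parallel, every vector normal to \<open>a\<close> serves as a common normal, for instance \<open>b\<close>.\<close>
    obtain n where n: "norm n = 1" "a \<bullet> n = 0" "a' \<bullet> n = 0"
    proof (cases "cross3 a a' = 0")
      case True
      then have "(a \<bullet> a') *\<^sub>R a - a' = 0"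
        using Lagrange[of a a a'] u by (simp add: norm_eq_1)
      then have "a' = (a \<bullet> a') *\<^sub>R a" by simp
      then have "a' \<bullet> b = 0" using u(3) by (metis inner_scaleR_left mult_zero_right)
      with u show ?thesis by (intro that[of b])
    next
      case False
      then show ?thesis
        by (intro that[of "sgn (cross3 a a')"])
           (simp_all add: norm_sgn sgn_div_norm dot_cross_self)
    qed
    have "connected_component ?F (a, b) (a, n)" using turn(1) u n by blast
    moreover have "connected_component ?F (a, n) (a', n)"
      using turn(2)[of n a a'] u n by (simp add: inner_commute)
    moreover have "connected_component ?F (a', n) (a', b')" using turn(1) u n by blast
    ultimately show ?thesis by (blast intro: connected_component_trans)
  qed
  then show ?thesis by (auto simp: connected_iff_connected_component)
qed

text \<open>A perigee state amounts to a distance, the squared speed as a multiple of its value on the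
  circular orbit, and an orthonormal frame.\<close>

lemma connected_apses:
  assumes mu: "\<mu> > 0" and rc: "r\<^sub>c \<ge> 0"
  shows "connected (apses \<mu> r\<^sub>c)"
proof -
  let ?D = "{r\<^sub>c<..} \<times> {1..<2 :: real} \<times> orthonormal_frames"
  let ?f = "\<lambda>(d, k, a, b). (d *\<^sub>R a, sqrt (k * (\<mu> / d)) *\<^sub>R b)"
  have "connected ?D"
    by (intro connected_Times connected_orthonormal_frames convex_connected) (auto intro: convex_real_interval)
  moreover have "continuous_on ?D ?f"
    unfolding case_prod_beta by (intro continuous_intros) (use rc in auto)
  ultimately have "connected (?f ` ?D)" by (intro connected_continuous_image)
  moreover have "?f ` ?D = apses \<mu> r\<^sub>c"
  proof (intro equalityI subsetI)
    fix x assume "x \<in> ?f ` ?D"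
    then obtain d k a b where d: "d > r\<^sub>c" and k: "1 \<le> k" "k < 2" and ab: "norm a = 1" "norm b = 1" "a \<bullet> b = 0"
      and x: "x = (d *\<^sub>R a, sqrt (k * (\<mu> / d)) *\<^sub>R b)"
      by (auto simp: orthonormal_frames_def)
    have m: "\<mu> / d > 0" using d rc mu by simp
    then have "(sqrt (k * (\<mu> / d)))\<^sup>2 = k * (\<mu> / d)"
      using k by (intro real_sqrt_pow2 mult_nonneg_nonneg) auto
    moreover have "1 * (\<mu> / d) \<le> k * (\<mu> / d)" using m k by (intro mult_right_mono) auto
    moreover have "k * (\<mu> / d) < 2 * (\<mu> / d)" using m k by (intro mult_strict_right_mono) auto
    ultimately show "x \<in> apses \<mu> r\<^sub>c"
      using d ab rc by (simp add: x apses_def del: times_divide_eq_right)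
  next
    fix x assume x: "x \<in> apses \<mu> r\<^sub>c"
    obtain r v where rv: "x = (r, v)" by (cases x)
    define k where "k = (norm v)\<^sup>2 / (\<mu> / norm r)"
    have a: "r \<bullet> v = 0" "norm r > r\<^sub>c" "\<mu> / norm r \<le> (norm v)\<^sup>2" "(norm v)\<^sup>2 < 2 * (\<mu> / norm r)"
      using x by (auto simp: apses_def rv)
    have r: "norm r > 0" using a rc by linarith
    then have mr: "\<mu> / norm r > 0" using mu by simp
    then have v: "norm v > 0" using a(3) by (smt (verit) norm_ge_zero zero_power2)
    have "1 \<le> k" "k < 2"
      unfolding k_def pos_le_divide_eq[OF mr] pos_divide_less_eq[OF mr] using a by simp_all
    moreover have "sqrt (k * (\<mu> / norm r)) = norm v"
    proof -
      have "y / e * e = y" if "e > 0" for y e :: real using that by simp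
      then have "k * (\<mu> / norm r) = (norm v)\<^sup>2" unfolding k_def using mr by blast
      then show ?thesis by simp
    qed
    moreover have "(sgn r, sgn v) \<in> orthonormal_frames"
      using r v a(1) by (simp add: orthonormal_frames_def norm_sgn sgn_div_norm)
    moreover have "norm r *\<^sub>R sgn r = r" "norm v *\<^sub>R sgn v = v"
      using r v by (simp_all add: sgn_div_norm)
    ultimately show "x \<in> ?f ` ?D"
      using a(2) rv by (intro image_eqI[of _ _ "(norm r, k, sgn r, sgn v)"]) auto
  qed
  ultimately show ?thesis by simp
qed

section \<open>Controllability\<close>

lemma reach_apses:
  assumes "\<mu> > 0" "\<beta> \<ge> 0" "\<tau>max > 0" "m\<^sub>0 > 0" "r\<^sub>c \<ge> 0"
    and "x \<in> apses \<mu> r\<^sub>c" "y \<in> apses \<mu> r\<^sub>c"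
  shows "reach \<mu> \<beta> r\<^sub>c \<tau>max m\<^sub>0 x y"
proof -
  let ?R = "reach \<mu> \<beta> r\<^sub>c \<tau>max m\<^sub>0"
  have "?R x y \<and> ?R y x"
  proof (rule connected_equivalence_relation[where R = "\<lambda>x y. ?R x y \<and> ?R y x"])
    show "connected (apses \<mu> r\<^sub>c)" by (rule connected_apses) fact+
    fix a assume a: "a \<in> apses \<mu> r\<^sub>c"
    have sub: "apses \<mu> r\<^sub>c \<subseteq> stable_periodic_region \<mu> r\<^sub>c" by (rule apses_subset_stable) fact+
    obtain U where U: "open U" "a \<in> U"
      "\<And>y z. y \<in> U \<Longrightarrow> z \<in> U \<inter> stable_periodic_region \<mu> r\<^sub>c \<Longrightarrow> ?R y z"
      using reach_locally[of \<mu> \<beta> \<tau>max m\<^sub>0 a r\<^sub>c] assms a sub by blast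
    show "\<exists>T. openin (top_of_set (apses \<mu> r\<^sub>c)) T \<and> a \<in> T \<and> (\<forall>x\<in>T. ?R a x \<and> ?R x a)"
    proof (intro exI[of _ "apses \<mu> r\<^sub>c \<inter> U"] conjI ballI)
      show "openin (top_of_set (apses \<mu> r\<^sub>c)) (apses \<mu> r\<^sub>c \<inter> U)"
        using U(1) by (rule openin_open_Int)
      fix x assume "x \<in> apses \<mu> r\<^sub>c \<inter> U"
      then show "?R a x" "?R x a" using U(2,3) a sub by blast+
    qed (use a U(2) in auto)
  qed (use assms in \<open>auto intro: reach_trans\<close>)
  then show ?thesis by simp
qed

theorem corollary1:
  fixes r\<^sub>c \<mu> \<beta> \<tau>max :: real
  assumes "r\<^sub>c > 0" and "\<mu> > 0" and "\<beta> > 0" and "\<tau>max > 0"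
  shows "controllable_orbital_transfer \<mu> \<beta> r\<^sub>c \<tau>max"
  unfolding controllable_orbital_transfer_def
proof (intro allI impI ballI)
  fix m\<^sub>i :: real and x\<^sub>i x\<^sub>f :: orbit_state
  assume m: "0 < m\<^sub>i" and xi: "x\<^sub>i \<in> stable_periodic_region \<mu> r\<^sub>c"
    and xf: "x\<^sub>f \<in> stable_periodic_region \<mu> r\<^sub>c"
  let ?R = "reach \<mu> \<beta> r\<^sub>c \<tau>max m\<^sub>i"
  obtain s where s: "coast \<mu> x\<^sub>i s \<in> apses \<mu> r\<^sub>c"
    using coast_meets_apses[OF assms(2) xi] .
  obtain s' where s': "coast \<mu> x\<^sub>f s' \<in> apses \<mu> r\<^sub>c"
    using coast_meets_apses[OF assms(2) xf] .
  have start: "coast \<mu> x\<^sub>i 0 = x\<^sub>i" "coast \<mu> x\<^sub>f 0 = x\<^sub>f"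
    using xi xf by (simp_all add: coast_0 stable_periodic_region_def periodic_region_def)
  have coasts: "?R x\<^sub>i (coast \<mu> x\<^sub>i s)" "?R (coast \<mu> x\<^sub>f s') x\<^sub>f"
    using reach_along_coast[OF assms(2) _ _ xi, of \<beta> \<tau>max m\<^sub>i 0 s]
      reach_along_coast[OF assms(2) _ _ xf, of \<beta> \<tau>max m\<^sub>i s' 0] assms start by simp_all
  have mid: "?R (coast \<mu> x\<^sub>i s) (coast \<mu> x\<^sub>f s')"
    using reach_apses[OF assms(2) _ assms(4) m _ s s', of \<beta>] assms by simp
  have "?R x\<^sub>i x\<^sub>f" by (rule reach_trans[OF reach_trans[OF coasts(1) mid] coasts(2)])
  then obtain m\<^sub>f where "transfer \<mu> \<beta> r\<^sub>c \<tau>max (x\<^sub>i, m\<^sub>i) (x\<^sub>f, m\<^sub>f)"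
    using m by (auto simp: reach_def)
  then show "\<exists>t\<^sub>f\<ge>0. \<exists>M\<^sub>0>0. \<exists>\<tau>. admissible_control \<tau>max t\<^sub>f \<tau> \<and>
          (\<exists>x m. trajectory_on \<mu> \<beta> \<tau> (x\<^sub>i, m\<^sub>i) t\<^sub>f x m \<and>
             (\<forall>t\<in>{0..t\<^sub>f}. x t \<in> admissible_region \<mu> r\<^sub>c \<and> m t \<ge> M\<^sub>0) \<and>
             x t\<^sub>f = x\<^sub>f)"
    by (rule transfer_imp_trajectory)
qed

end
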